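(* Let $G$ be a non-discrete totally disconnected locally compact second-countable group, and let $\mathcal{LN}(G)^G$ be the set of fixed points of the conjugation action of $G$ on $\mathcal{LN}(G)$. (i) If $G$ is topologically simple, then $\mathcal{LN}(G)^G \smallsetminus \{0\}$ is an upper subset of $\mathcal{LN}(G)$. (ii) If $G$ is monolithic, locally C-stable and has trivial quasi-centre, then $\mathcal{LN}(G)^G \smallsetminus \{0\}$ is closed under meets. Hence if $G$ is topologically simple and locally C-stable, then $\mathcal{LN}(G)^G \smallsetminus \{0\}$ is a filter on $\mathcal{LN}(G)$.
   Context: Let $G$ be a totally disconnected locally compact group. $G$ is topologically simple if it is non-trivial and its only closed normal subgroups are $\{1\}$ and $G$. A subgroup of $G$ is locally normal if its normaliser in $G$ is open. The structure lattice $\mathcal{LN}(G)$ is the set of closed locally normal subgroups of $G$ modulo $H \sim K$ iff $H \cap K$ is open in both $H$ and $K$; the class of $H$ is $[H]$. It is a lattice for the order $\alpha \le \beta$ iff $H \le K$ for some $H \in \alpha$, $K \in \beta$; $0$ is the class of $\{1\}$. $G$ acts by conjugation, $g[H] = [gHg^{-1}]$. For subgroups $H,K$ of $G$, the quasi-centraliser of $K$ in $H$ is $\mathrm{QC}_H(K) = \bigcup_U \mathrm{C}_H(K \cap U)$, the union over all compact open subgroups $U$ of $G$; the quasi-centre of $G$ is $\mathrm{QZ}(G) = \mathrm{QC}_G(G)$. A closed subgroup $H$ is C-stable in $G$ if $\mathrm{QC}_G(H) \cap \mathrm{QC}_G(\mathrm{C}_G(H))$ is discrete; $G$ is locally C-stable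 if all closed locally normal subgroups of $G$ are C-stable in $G$. $G$ is monolithic if the intersection of all its non-trivial closed normal subgroups is non-trivial. An upper subset of a poset $X$ is a subset $Y$ such that $y \in Y$, $x \in X$, $y \le x$ imply $x \in Y$. A filter of a lattice is an upper subset closed under meets. *)

theory Defs
  imports "HOL-Algebra.Group_Action" "HOL-Algebra.Lattice" "HOL-Analysis.Analysis"
begin

section \<open>Totally disconnected locally compact groups\<close>

locale topological_group = group G for G (structure) +
  fixes T :: "'a topology"
  assumes topspace_eq: "topspace T = carrier G"
    and continuous_mult: "continuous_map (prod_topology T T) T (\<lambda>(x, y). x \<otimes> y)"
    and continuous_inv: "continuous_map T T (\<lambda>x. inv x)"

definition totally_disconnected :: "'a topology \<Rightarrow> bool" where
  "totally_disconnected T \<longleftrightarrow> (\<forall>x \<in> topspace T. connected_component_of_set T x = {x})"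

text \<open>The Hausdorff property is not listed separately: connected components are closed, so a
  totally disconnected group is T1, and a T1 topological group is Hausdorff.\<close>

locale tdlc_group = topological_group +
  assumes totally_disconnected: "totally_disconnected T"
    and locally_compact: "locally_compact_space T"

text \<open>The type class \<open>second_countable_topology\<close> does not apply to topologies on a carrier set.\<close>

definition second_countable_space :: "'a topology \<Rightarrow> bool" where
  "second_countable_space T \<longleftrightarrow>
     (\<exists>\<B>. countable \<B> \<and> openin T = arbitrary union_of (\<lambda>V. V \<in> \<B>))"

definition discrete_in :: "'a topology \<Rightarrow> 'a set \<Rightarrow> bool" where
  "discrete_in T S \<longleftrightarrow> subtopology T S = discrete_topology S"

definition topologically_simple :: "('a, 'b) monoid_scheme \<Rightarrow> 'a topology \<Rightarrow> bool" where
  "topologically_simple G T \<longleftrightarrow>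
     carrier G \<noteq> {\<one>\<^bsub>G\<^esub>} \<and>
     (\<forall>N. N \<lhd> G \<and> closedin T N \<longrightarrow> N = {\<one>\<^bsub>G\<^esub>} \<or> N = carrier G)"

text \<open>Intersecting with the carrier makes the trivial group, for which the family is empty,
  non-monolithic.\<close>

definition monolithic :: "('a, 'b) monoid_scheme \<Rightarrow> 'a topology \<Rightarrow> bool" where
  "monolithic G T \<longleftrightarrow>
     carrier G \<inter> \<Inter>{N. N \<lhd> G \<and> closedin T N \<and> N \<noteq> {\<one>\<^bsub>G\<^esub>}} \<noteq> {\<one>\<^bsub>G\<^esub>}"


section \<open>Locally normal subgroups and quasi-centralisers\<close>

definition closed_locally_normal :: "('a, 'b) monoid_scheme \<Rightarrow> 'a topology \<Rightarrow> 'a set \<Rightarrow> bool" where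
  "closed_locally_normal G T H \<longleftrightarrow>
     subgroup H G \<and> closedin T H \<and> openin T (normalizer G H)"

definition centraliser_in :: "('a, 'b) monoid_scheme \<Rightarrow> 'a set \<Rightarrow> 'a set \<Rightarrow> 'a set" where
  "centraliser_in G H K = {h \<in> H. \<forall>k \<in> K. h \<otimes>\<^bsub>G\<^esub> k = k \<otimes>\<^bsub>G\<^esub> h}"

definition quasi_centraliser_in ::
    "('a, 'b) monoid_scheme \<Rightarrow> 'a topology \<Rightarrow> 'a set \<Rightarrow> 'a set \<Rightarrow> 'a set" where
  "quasi_centraliser_in G T H K =
     (\<Union>U \<in> {U. subgroup U G \<and> compactin T U \<and> openin T U}. centraliser_in G H (K \<inter> U))"

definition quasi_centre :: "('a, 'b) monoid_scheme \<Rightarrow> 'a topology \<Rightarrow> 'a set" where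
  "quasi_centre G T = quasi_centraliser_in G T (carrier G) (carrier G)"

definition C_stable :: "('a, 'b) monoid_scheme \<Rightarrow> 'a topology \<Rightarrow> 'a set \<Rightarrow> bool" where
  "C_stable G T H \<longleftrightarrow>
     subgroup H G \<and> closedin T H \<and>
     discrete_in T (quasi_centraliser_in G T (carrier G) H \<inter>
       quasi_centraliser_in G T (carrier G) (centraliser_in G (carrier G) H))"

definition locally_C_stable :: "('a, 'b) monoid_scheme \<Rightarrow> 'a topology \<Rightarrow> bool" where
  "locally_C_stable G T \<longleftrightarrow> (\<forall>H. closed_locally_normal G T H \<longrightarrow> C_stable G T H)"


section \<open>The structure lattice\<close>

definition local_equiv :: "('a, 'b) monoid_scheme \<Rightarrow> 'a topology \<Rightarrow> ('a set \<times> 'a set) set" where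
  "local_equiv G T =
     {(H, K). closed_locally_normal G T H \<and> closed_locally_normal G T K \<and>
        openin (subtopology T H) (H \<inter> K) \<and> openin (subtopology T K) (H \<inter> K)}"

definition structure_lattice :: "('a, 'b) monoid_scheme \<Rightarrow> 'a topology \<Rightarrow> 'a set set gorder" where
  "structure_lattice G T =
     \<lparr>carrier = {H. closed_locally_normal G T H} // local_equiv G T,
      eq = (=),
      le = (\<lambda>\<alpha> \<beta>. \<exists>H \<in> \<alpha>. \<exists>K \<in> \<beta>. H \<subseteq> K)\<rparr>"

definition LN_zero :: "('a, 'b) monoid_scheme \<Rightarrow> 'a topology \<Rightarrow> 'a set set" where
  "LN_zero G T = local_equiv G T `` {{\<one>\<^bsub>G\<^esub>}}"

text \<open>Conjugation respects \<^const>\<open>local_equiv\<close>, so the elementwise image of the class of \<open>H\<close>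
  is the class of the conjugate of \<open>H\<close>.\<close>

definition conj_class :: "('a, 'b) monoid_scheme \<Rightarrow> 'a \<Rightarrow> 'a set set \<Rightarrow> 'a set set" where
  "conj_class G g \<alpha> = (\<lambda>H. g <#\<^bsub>G\<^esub> H #>\<^bsub>G\<^esub> inv\<^bsub>G\<^esub> g) ` \<alpha>"

definition LN_fixed :: "('a, 'b) monoid_scheme \<Rightarrow> 'a topology \<Rightarrow> 'a set set set" where
  "LN_fixed G T =
     {\<alpha> \<in> carrier (structure_lattice G T). \<forall>g \<in> carrier G. conj_class G g \<alpha> = \<alpha>}"


section \<open>Upper subsets and filters\<close>

definition upper_subset :: "('a, 'b) gorder_scheme \<Rightarrow> 'a set \<Rightarrow> bool" where
  "upper_subset L Y \<longleftrightarrow>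
     Y \<subseteq> carrier L \<and> (\<forall>y \<in> Y. \<forall>x \<in> carrier L. y \<sqsubseteq>\<^bsub>L\<^esub> x \<longrightarrow> x \<in> Y)"

definition meet_closed :: "('a, 'b) gorder_scheme \<Rightarrow> 'a set \<Rightarrow> bool" where
  "meet_closed L Y \<longleftrightarrow> (\<forall>x \<in> Y. \<forall>y \<in> Y. x \<sqinter>\<^bsub>L\<^esub> y \<in> Y)"

definition lattice_filter :: "('a, 'b) gorder_scheme \<Rightarrow> 'a set \<Rightarrow> bool" where
  "lattice_filter L Y \<longleftrightarrow> upper_subset L Y \<and> meet_closed L Y"

end

theory Submission
  imports Defs
begin

text \<open>Two subgroups represent the same class iff each contains the other near the identity, so
  everything is phrased through local containment of germs.

  (i) Let \<open>[H] \<noteq> 0\<close> be fixed and \<open>H \<le> K\<close>. If \<open>g \<in> x H x\<^sup>-\<^sup>1\<close> and \<open>k \<in> K\<close> is near \<open>1\<close>, then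
  \<open>k\<^sup>-\<^sup>1 g k g\<^sup>-\<^sup>1\<close> lies in \<open>x H x\<^sup>-\<^sup>1\<close> and is near \<open>1\<close>, hence lies in \<open>H \<le> K\<close>. So \<open>g\<close> fixes \<open>[K]\<close>. The
  stabiliser of \<open>[K]\<close> is an open, hence closed, subgroup; its normal core is a closed normal
  subgroup containing \<open>H \<noteq> 1\<close>, so it is \<open>G\<close>.

  (ii) Let \<open>[H]\<close> be fixed, \<open>A = QC(H)\<close> and \<open>D = A \<inter> QC(C(H))\<close>. The subgroup \<open>D\<close> is discrete and
  normalised by the open subgroup \<open>N(H)\<close>, so it lies in the quasi-centre and is trivial. As \<open>[H]\<close> is
  fixed, \<open>A\<close> is normal in \<open>G\<close>, and \<open>[A \<inter> N(H), H] \<le> A \<inter> H \<le> D\<close> shows that \<open>A\<close> and \<open>C(H)\<close> agree near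
  \<open>1\<close>. Hence \<open>QC(C(H)) = QC(A)\<close> is normal as well, so \<open>[A, H] \<le> D\<close> and \<open>A = C(H)\<close> is closed. If
  \<open>[H] \<and> [K] = 0\<close> with \<open>[K] \<noteq> 0\<close>, then \<open>H\<close> and \<open>K\<close> commute near \<open>1\<close>, so \<open>A \<noteq> 1\<close> and both \<open>A\<close> and
  \<open>C(A) \<ge> H\<close> contain the monolith, although \<open>A \<inter> C(A) \<le> D\<close> is trivial.\<close>

section \<open>Topological groups\<close>

context topological_group
begin

lemma continuous_map_mult [continuous_intros]:
  assumes "continuous_map X T f" "continuous_map X T g"
  shows "continuous_map X T (\<lambda>x. f x \<otimes> g x)"
proof -
  have "continuous_map X (prod_topology T T) (\<lambda>x. (f x, g x))"
    using assms by (simp add: continuous_map_pairedI)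
  from continuous_map_compose[OF this continuous_mult] show ?thesis
    by (simp add: o_def)
qed

lemma continuous_map_inv [continuous_intros]:
  assumes "continuous_map X T f"
  shows "continuous_map X T (\<lambda>x. inv (f x))"
  using continuous_map_compose[OF assms continuous_inv] by (simp add: o_def)

lemma continuous_map_group_const [continuous_intros]:
  "a \<in> carrier G \<Longrightarrow> continuous_map X T (\<lambda>x. a)"
  by (simp add: topspace_eq)

lemma continuous_map_ident [continuous_intros]: "continuous_map T T (\<lambda>x. x)"
  by simp

lemma openin_preimage:
  assumes "continuous_map T T f" "openin T U"
  shows "openin T {x \<in> carrier G. f x \<in> U}"
  using openin_continuous_map_preimage[OF assms] by (simp add: topspace_eq)

lemma closedin_preimage:
  assumes "continuous_map T T f" "closedin T U"
  shows "closedin T {x \<in> carrier G. f x \<in> U}"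
  using closedin_continuous_map_preimage[OF assms] by (simp add: topspace_eq)

lemma openin_carrier: "openin T U \<Longrightarrow> U \<subseteq> carrier G"
  using openin_subset topspace_eq by blast

lemma openin_whole: "openin T (carrier G)"
  using openin_topspace[of T] by (simp add: topspace_eq)

text \<open>With each point \<open>x\<close> the subgroup contains the translate x V, which is a
  neighbourhood of \<open>x\<close>.\<close>

lemma subgroup_openinI:
  assumes S: "subgroup S G" and V: "openin T V" "\<one> \<in> V" "V \<subseteq> S"
  shows "openin T S"
proof (subst openin_subopen, rule ballI)
  fix x assume x: "x \<in> S"
  then have xc: "x \<in> carrier G" by (rule subgroup.mem_carrier[OF S])
  let ?W = "{y \<in> carrier G. inv x \<otimes> y \<in> V}"
  have "openin T ?W"
    using xc V by (intro openin_preimage continuous_intros) auto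
  moreover have "x \<in> ?W" using xc V by simp
  moreover have "?W \<subseteq> S"
  proof
    fix y assume y: "y \<in> ?W"
    then have "x \<otimes> (inv x \<otimes> y) \<in> S"
      using subgroup.m_closed[OF S x] V by auto
    then show "y \<in> S" using xc y by (simp add: m_assoc[symmetric])
  qed
  ultimately show "\<exists>W. openin T W \<and> x \<in> W \<and> W \<subseteq> S" by (intro exI conjI)
qed

text \<open>The complement is a union of left cosets of \<open>S\<close>, and these are
  open.\<close>

lemma open_subgroup_closedin:
  assumes S: "subgroup S G" "openin T S"
  shows "closedin T S"
proof -
  have "openin T (carrier G - S)"
  proof (subst openin_subopen, rule ballI)
    fix x assume x: "x \<in> carrier G - S"
    let ?W = "{y \<in> carrier G. inv x \<otimes> y \<in> S}"
    have "openin T ?W"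
      using x S by (intro openin_preimage continuous_intros) auto
    moreover have "x \<in> ?W" using x S by (simp add: subgroup.one_closed)
    moreover have "?W \<subseteq> carrier G - S"
    proof
      fix y assume y: "y \<in> ?W"
      { assume "y \<in> S"
        then have "y \<otimes> inv (inv x \<otimes> y) \<in> S"
          using y by (simp add: subgroup.m_closed[OF S(1)] subgroup.m_inv_closed[OF S(1)])
        moreover have "y \<otimes> inv (inv x \<otimes> y) = x"
          using x y by (simp add: inv_mult_group m_assoc[symmetric])
        ultimately have False using x by simp }
      then show "y \<in> carrier G - S" using y by auto
    qed
    ultimately show "\<exists>W. openin T W \<and> x \<in> W \<and> W \<subseteq> carrier G - S" by (intro exI conjI)
  qed
  then show ?thesis
    using S by (simp add: closedin_def topspace_eq subgroup.subset)
qed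

text \<open>The diagonal is the preimage of \<open>{\<one>}\<close> under the continuous map (x, y)
  -> x^-1 y.\<close>

lemma Hausdorff_if_closed_one:
  assumes "closedin T {\<one>}"
  shows "Hausdorff_space T"
proof -
  have "continuous_map (prod_topology T T) T (\<lambda>z. inv (fst z) \<otimes> snd z)"
    by (intro continuous_intros continuous_map_fst continuous_map_snd)
  from closedin_continuous_map_preimage[OF this assms]
  have "closedin (prod_topology T T) {z \<in> carrier G \<times> carrier G. inv (fst z) \<otimes> snd z = \<one>}"
    by (simp add: topspace_eq)
  moreover have "{z \<in> carrier G \<times> carrier G. inv (fst z) \<otimes> snd z = \<one>}
      = (\<lambda>x. (x, x)) ` topspace T"
    by (auto simp: topspace_eq image_iff) (metis inv_closed inv_equality inv_inv)
  ultimately show ?thesis by (simp add: Hausdorff_space_closedin_diagonal)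
qed

end


section \<open>Conjugates and normalisers\<close>

context group
begin

text \<open>The same expression occurs in \<open>conj_class\<close> and in the action behind
  \<open>normalizer\<close>, so facts about it transfer to both by unfolding.\<close>

definition conjugate_set :: "'a \<Rightarrow> 'a set \<Rightarrow> 'a set"
  where "conjugate_set g H = (g <# H) #> inv g"

text \<open>Seeing a conjugate as a preimage under x -> g^-1 x g, rather than as an image, lets
  continuity apply and reduces identities between conjugates to computations with elements.\<close>

lemma conjugate_set_iff:
  assumes "g \<in> carrier G" "H \<subseteq> carrier G"
  shows "x \<in> conjugate_set g H \<longleftrightarrow> x \<in> carrier G \<and> inv g \<otimes> x \<otimes> g \<in> H"
proof
  assume "x \<in> conjugate_set g H"
  then obtain h where h: "h \<in> H" "x = g \<otimes> h \<otimes> inv g"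
    unfolding conjugate_set_def l_coset_def r_coset_def by blast
  with assms have "h \<in> carrier G" by blast
  then have "inv g \<otimes> x \<otimes> g = h"
    using h assms by (simp add: m_assoc) (simp add: m_assoc[symmetric])
  then show "x \<in> carrier G \<and> inv g \<otimes> x \<otimes> g \<in> H" using h assms by auto
next
  assume x: "x \<in> carrier G \<and> inv g \<otimes> x \<otimes> g \<in> H"
  have "x = g \<otimes> (inv g \<otimes> x \<otimes> g) \<otimes> inv g"
    using x assms by (simp add: m_assoc) (simp add: m_assoc[symmetric])
  then show "x \<in> conjugate_set g H"
    using x unfolding conjugate_set_def l_coset_def r_coset_def by blast
qed

lemma conjugate_set_subset:
  assumes "g \<in> carrier G" "H \<subseteq> carrier G"
  shows "conjugate_set g H \<subseteq> carrier G"
  using conjugate_set_iff[OF assms] by blast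

lemma conjugate_set_conjugate_set:
  assumes "a \<in> carrier G" "b \<in> carrier G" "H \<subseteq> carrier G"
  shows "conjugate_set a (conjugate_set b H) = conjugate_set (a \<otimes> b) H"
proof -
  have "inv b \<otimes> (inv a \<otimes> x \<otimes> a) \<otimes> b = inv (a \<otimes> b) \<otimes> x \<otimes> (a \<otimes> b)" if "x \<in> carrier G" for x
    using assms that by (simp add: inv_mult_group m_assoc)
  then show ?thesis
    using assms conjugate_set_subset[of b H]
    by (intro Set.set_eqI) (auto simp: conjugate_set_iff)
qed

lemma conjugate_set_one:
  assumes "H \<subseteq> carrier G"
  shows "conjugate_set \<one> H = H"
  using assms by (auto simp: conjugate_set_iff subset_iff)

lemma conjugate_set_cancel:
  assumes "g \<in> carrier G" "H \<subseteq> carrier G"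
  shows "conjugate_set (inv g) (conjugate_set g H) = H"
    and "conjugate_set g (conjugate_set (inv g) H) = H"
  using conjugate_set_conjugate_set[of "inv g" g H] conjugate_set_conjugate_set[of g "inv g" H]
    conjugate_set_one[of H] assms by simp_all

lemma normalizer_iff:
  assumes "H \<subseteq> carrier G"
  shows "g \<in> normalizer G H \<longleftrightarrow> g \<in> carrier G \<and> conjugate_set g H = H"
  using assms by (simp add: normalizer_def stabilizer_def conjugate_set_def)

lemma normalizer_conj_closed:
  assumes "H \<subseteq> carrier G" "g \<in> normalizer G H" "h \<in> H"
  shows "g \<otimes> h \<otimes> inv g \<in> H"
proof -
  have "g \<otimes> h \<otimes> inv g \<in> conjugate_set g H"
    using assms(3) unfolding conjugate_set_def l_coset_def r_coset_def by blast
  then show ?thesis using assms by (simp add: normalizer_iff)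
qed

lemma subgroup_conjugate_set:
  assumes "subgroup H G" "g \<in> carrier G"
  shows "subgroup (conjugate_set g H) G"
proof -
  have Hc: "H \<subseteq> carrier G" using assms subgroup.subset by blast
  show ?thesis
  proof (rule subgroupI)
    show "conjugate_set g H \<subseteq> carrier G" using conjugate_set_subset assms Hc by blast
    have "\<one> \<in> conjugate_set g H"
      using assms Hc by (simp add: conjugate_set_iff subgroup.one_closed)
    then show "conjugate_set g H \<noteq> {}" by blast
  next
    fix a assume "a \<in> conjugate_set g H"
    then have a: "a \<in> carrier G" "inv g \<otimes> a \<otimes> g \<in> H"
      using assms Hc by (auto simp: conjugate_set_iff)
    have "inv (inv g \<otimes> a \<otimes> g) = inv g \<otimes> inv a \<otimes> g"
      using a assms by (simp add: inv_mult_group m_assoc)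
    then show "inv a \<in> conjugate_set g H"
      using a assms Hc subgroup.m_inv_closed[OF assms(1) a(2)] by (simp add: conjugate_set_iff)
  next
    fix a b assume "a \<in> conjugate_set g H" "b \<in> conjugate_set g H"
    then have ab: "a \<in> carrier G" "inv g \<otimes> a \<otimes> g \<in> H" "b \<in> carrier G" "inv g \<otimes> b \<otimes> g \<in> H"
      using assms Hc by (auto simp: conjugate_set_iff)
    have "(inv g \<otimes> a \<otimes> g) \<otimes> (inv g \<otimes> b \<otimes> g) = inv g \<otimes> (a \<otimes> b) \<otimes> g"
      using ab assms by (simp add: m_assoc inv_solve_left) (simp add: m_assoc[symmetric])
    then show "a \<otimes> b \<in> conjugate_set g H"
      using ab assms Hc subgroup.m_closed[OF assms(1) ab(2,4)] by (simp add: conjugate_set_iff)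
  qed
qed

text \<open>Conjugating the equation x (g H g^-1) x^-1 = g H g^-1 back by g^-1 says that g^-1 x g
  fixes \<open>H\<close>.\<close>

lemma normalizer_conjugate_set:
  assumes "H \<subseteq> carrier G" "g \<in> carrier G"
  shows "normalizer G (conjugate_set g H) = conjugate_set g (normalizer G H)"
proof -
  have N: "normalizer G H \<subseteq> carrier G"
    using normalizer_imp_subgroup[OF assms(1)] subgroup.subset by blast
  have c: "conjugate_set g H \<subseteq> carrier G" using conjugate_set_subset assms by blast
  have "conjugate_set x (conjugate_set g H) = conjugate_set g H \<longleftrightarrow>
      conjugate_set (inv g \<otimes> x \<otimes> g) H = H" if x: "x \<in> carrier G" for x
  proof -
    have "conjugate_set (inv g) (conjugate_set x (conjugate_set g H))
        = conjugate_set (inv g \<otimes> x \<otimes> g) H"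
      using x assms c by (simp add: conjugate_set_conjugate_set m_assoc conjugate_set_subset)
    then show ?thesis
      using conjugate_set_cancel(1)[OF assms(2,1)]
        conjugate_set_cancel(2)[OF assms(2) conjugate_set_subset[OF x c]] by (intro iffI) simp_all
  qed
  then show ?thesis
    using assms N c by (auto simp: normalizer_iff conjugate_set_iff)
qed

lemma normalizer_Int:
  assumes "H \<subseteq> carrier G" "K \<subseteq> carrier G"
  shows "normalizer G H \<inter> normalizer G K \<subseteq> normalizer G (H \<inter> K)"
proof
  fix g assume g: "g \<in> normalizer G H \<inter> normalizer G K"
  then have "g \<in> carrier G" "conjugate_set g H = H" "conjugate_set g K = K"
    using assms by (auto simp: normalizer_iff)
  moreover from this have "conjugate_set g (H \<inter> K) = H \<inter> K"
    using assms
    by (intro Set.set_eqI) (metis Int_iff conjugate_set_iff le_infI1)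
  ultimately show "g \<in> normalizer G (H \<inter> K)"
    using assms normalizer_iff[of "H \<inter> K" g] by blast
qed

lemma commute_iff_conj:
  assumes "x \<in> carrier G" "y \<in> carrier G"
  shows "x \<otimes> y = y \<otimes> x \<longleftrightarrow> x \<otimes> y \<otimes> inv x = y"
  using assms by (metis inv_solve_right m_closed)

lemma commute_inv:
  assumes "x \<in> carrier G" "y \<in> carrier G" "x \<otimes> y = y \<otimes> x"
  shows "inv x \<otimes> y = y \<otimes> inv x"
  using assms by (metis inv_closed inv_solve_left inv_solve_right m_assoc m_closed)

lemma commute_mult:
  assumes "a \<in> carrier G" "b \<in> carrier G" "y \<in> carrier G" "a \<otimes> y = y \<otimes> a" "b \<otimes> y = y \<otimes> b"
  shows "a \<otimes> b \<otimes> y = y \<otimes> (a \<otimes> b)"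
  using assms by (metis m_assoc)

lemma commute_conj:
  assumes "g \<in> carrier G" "x \<in> carrier G" "k \<in> carrier G"
    and "x \<otimes> (inv g \<otimes> k \<otimes> g) = (inv g \<otimes> k \<otimes> g) \<otimes> x"
  shows "(g \<otimes> x \<otimes> inv g) \<otimes> k = k \<otimes> (g \<otimes> x \<otimes> inv g)"
proof -
  have "(g \<otimes> x \<otimes> inv g) \<otimes> k = g \<otimes> (x \<otimes> (inv g \<otimes> k \<otimes> g)) \<otimes> inv g"
    using assms(1-3) by (simp add: m_assoc)
  also have "\<dots> = k \<otimes> (g \<otimes> x \<otimes> inv g)"
    unfolding assms(4) using assms(1-3) by (simp add: m_assoc) (simp add: m_assoc[symmetric])
  finally show ?thesis .
qed

lemma commute_if_commutator_one:
  assumes "x \<in> carrier G" "y \<in> carrier G" "x \<otimes> y \<otimes> inv x \<otimes> inv y = \<one>"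
  shows "x \<otimes> y = y \<otimes> x"
proof -
  have "inv (inv y) = x \<otimes> y \<otimes> inv x" using assms by (intro inv_equality) simp_all
  then show ?thesis using assms(1,2) by (simp add: commute_iff_conj)
qed

lemma conjugate_set_normal:
  assumes "N \<lhd> G" "g \<in> carrier G"
  shows "conjugate_set g N = N"
proof -
  have N: "N \<subseteq> carrier G" using assms(1) by (simp add: normal_imp_subgroup subgroup.subset)
  have "x \<in> N" if "x \<in> carrier G" "inv g \<otimes> x \<otimes> g \<in> N" for x
  proof -
    have "g \<otimes> (inv g \<otimes> x \<otimes> g) \<otimes> inv g \<in> N" by (rule normal_invE(2)[OF assms that(2)])
    then show ?thesis using that assms(2) by (simp add: m_assoc) (simp add: m_assoc[symmetric])
  qed
  moreover have "inv g \<otimes> x \<otimes> g \<in> N" if "x \<in> N" for x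
    using normal.inv_op_closed1[OF assms(1)] assms(2) that by simp
  ultimately show ?thesis using N assms(2) by (auto simp: conjugate_set_iff)
qed

abbreviation centr :: "'a set \<Rightarrow> 'a set"
  where "centr K \<equiv> centraliser_in G (carrier G) K"

lemma subgroup_centr: "K \<subseteq> carrier G \<Longrightarrow> subgroup (centr K) G"
  by (rule subgroupI)
    (auto simp: centraliser_in_def subset_iff commute_inv commute_mult intro!: exI[of _ \<one>])

lemma conj_mem_centr:
  assumes "x \<in> centr K" "g \<in> carrier G" "K \<subseteq> carrier G"
  shows "g \<otimes> x \<otimes> inv g \<in> centr (conjugate_set g K)"
  using assms commute_conj[OF assms(2), of x]
  by (auto simp: centraliser_in_def conjugate_set_iff)

text \<open>Conjugation by \<open>g\<close> carries the centraliser of \<open>N\<close> into that of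
  g N g^-1, which is \<open>N\<close> again.\<close>

lemma normal_centr:
  assumes "N \<lhd> G" shows "centr N \<lhd> G"
proof (rule normal_invI)
  have N: "N \<subseteq> carrier G" using assms by (simp add: normal_imp_subgroup subgroup.subset)
  then show "subgroup (centr N) G" by (rule subgroup_centr)
  fix g x assume "g \<in> carrier G" "x \<in> centr N"
  then show "g \<otimes> x \<otimes> inv g \<in> centr N"
    using conj_mem_centr[of x N g] conjugate_set_normal[OF assms] N by simp
qed

end


section \<open>Local containment\<close>

context topological_group
begin

lemma continuous_map_conj:
  "a \<in> carrier G \<Longrightarrow> b \<in> carrier G \<Longrightarrow> continuous_map T T (\<lambda>x. a \<otimes> x \<otimes> b)"
  by (intro continuous_intros)

lemma openin_conjugate_set:
  assumes "g \<in> carrier G" "openin T U"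
  shows "openin T (conjugate_set g U)"
proof -
  have "conjugate_set g U = {x \<in> carrier G. inv g \<otimes> x \<otimes> g \<in> U}"
    using conjugate_set_iff[OF assms(1) openin_carrier[OF assms(2)]] by auto
  then show ?thesis
    using openin_preimage[OF continuous_map_conj assms(2), of "inv g" g] assms(1) by simp
qed

lemma closedin_conjugate_set:
  assumes "g \<in> carrier G" "closedin T U"
  shows "closedin T (conjugate_set g U)"
proof -
  have "U \<subseteq> carrier G" using closedin_subset[OF assms(2)] topspace_eq by simp
  then have "conjugate_set g U = {x \<in> carrier G. inv g \<otimes> x \<otimes> g \<in> U}"
    using conjugate_set_iff[OF assms(1)] by auto
  then show ?thesis
    using closedin_preimage[OF continuous_map_conj assms(2), of "inv g" g] assms(1) by simp
qed

text \<open>Containment of germs at the identity. It is defined for arbitrary sets, so that it also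
  compares quasi-centralisers, which need not be closed.\<close>

definition germ_le :: "'a set \<Rightarrow> 'a set \<Rightarrow> bool"
  where "germ_le A B \<longleftrightarrow> (\<exists>V. openin T V \<and> \<one> \<in> V \<and> A \<inter> V \<subseteq> B)"

lemma germ_leI: "openin T V \<Longrightarrow> \<one> \<in> V \<Longrightarrow> A \<inter> V \<subseteq> B \<Longrightarrow> germ_le A B"
  unfolding germ_le_def by (intro exI conjI)

lemma germ_leE:
  assumes "germ_le A B"
  obtains V where "openin T V" "\<one> \<in> V" "A \<inter> V \<subseteq> B"
  using assms unfolding germ_le_def by (elim exE conjE)

lemma germ_le_subset:
  assumes "A \<subseteq> B" shows "germ_le A B"
proof (rule germ_leI)
  show "openin T (carrier G)" by (rule openin_whole)
qed (use assms in auto)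

lemma germ_le_Int:
  assumes "germ_le A B" "germ_le A C"
  shows "germ_le A (B \<inter> C)"
proof -
  obtain V where V: "openin T V" "\<one> \<in> V" "A \<inter> V \<subseteq> B" using assms(1) by (rule germ_leE)
  obtain W where W: "openin T W" "\<one> \<in> W" "A \<inter> W \<subseteq> C" using assms(2) by (rule germ_leE)
  show ?thesis
    by (rule germ_leI[OF openin_Int[OF V(1) W(1)]]) (use V W in auto)
qed

lemma germ_le_trans:
  assumes "germ_le A B" "germ_le B C"
  shows "germ_le A C"
proof -
  obtain V where V: "openin T V" "\<one> \<in> V" "A \<inter> V \<subseteq> B" using assms(1) by (rule germ_leE)
  obtain W where W: "openin T W" "\<one> \<in> W" "B \<inter> W \<subseteq> C" using assms(2) by (rule germ_leE)
  show ?thesis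
    by (rule germ_leI[OF openin_Int[OF V(1) W(1)]]) (use V W in auto)
qed

lemma germ_le_conjugate_set:
  assumes "germ_le A B" "g \<in> carrier G" "A \<subseteq> carrier G" "B \<subseteq> carrier G"
  shows "germ_le (conjugate_set g A) (conjugate_set g B)"
proof -
  obtain V where V: "openin T V" "\<one> \<in> V" "A \<inter> V \<subseteq> B" using assms(1) by (rule germ_leE)
  have Vc: "V \<subseteq> carrier G" using V(1) by (rule openin_carrier)
  show ?thesis
  proof (rule germ_leI)
    show "openin T (conjugate_set g V)" by (rule openin_conjugate_set[OF assms(2) V(1)])
  qed (use V Vc assms in \<open>auto simp: conjugate_set_iff\<close>)
qed

text \<open>\<open>germ_le\<close> is openness at the identity; left translation by an element
  \<open>x\<close> of \<open>A \<inter> B\<close> carries it to \<open>x\<close>.\<close>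

lemma openin_subgroup_Int_iff:
  assumes "subgroup A G" "subgroup B G"
  shows "openin (subtopology T A) (A \<inter> B) \<longleftrightarrow> germ_le A B"
proof
  assume "openin (subtopology T A) (A \<inter> B)"
  then obtain V where V: "openin T V" "A \<inter> B = V \<inter> A"
    unfolding openin_subtopology by (elim exE conjE)
  have "\<one> \<in> A \<inter> B" using assms by (simp add: subgroup.one_closed)
  then show "germ_le A B" using V by (intro germ_leI[of V]) auto
next
  assume "germ_le A B"
  then obtain V where V: "openin T V" "\<one> \<in> V" "A \<inter> V \<subseteq> B" by (rule germ_leE)
  show "openin (subtopology T A) (A \<inter> B)"
  proof (subst openin_subopen, rule ballI)
    fix x assume x: "x \<in> A \<inter> B"
    then have xc: "x \<in> carrier G" using subgroup.mem_carrier[OF assms(1)] by simp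
    let ?W = "{y \<in> carrier G. inv x \<otimes> y \<in> V}"
    have "openin T ?W"
      using xc V by (intro openin_preimage continuous_intros) auto
    then have "openin (subtopology T A) (?W \<inter> A)"
      unfolding openin_subtopology by (intro exI conjI) (assumption, rule refl)
    moreover have "x \<in> ?W \<inter> A" using x xc V by simp
    moreover have "?W \<inter> A \<subseteq> A \<inter> B"
    proof
      fix y assume y: "y \<in> ?W \<inter> A"
      then have "inv x \<otimes> y \<in> A"
        using x by (simp add: subgroup.m_closed[OF assms(1)] subgroup.m_inv_closed[OF assms(1)])
      then have "x \<otimes> (inv x \<otimes> y) \<in> B"
        using x y V(3) subgroup.m_closed[OF assms(2)] by auto
      then show "y \<in> A \<inter> B" using xc y by (simp add: m_assoc[symmetric])
    qed
    ultimately show "\<exists>W. openin (subtopology T A) W \<and> x \<in> W \<and> W \<subseteq> A \<inter> B"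
      by (intro exI conjI)
  qed
qed


section \<open>Closed locally normal subgroups\<close>

abbreviation cln :: "'a set \<Rightarrow> bool"
  where "cln \<equiv> closed_locally_normal G T"

lemma clnD:
  assumes "cln H"
  shows "subgroup H G" "closedin T H" "openin T (normalizer G H)" "H \<subseteq> carrier G"
  using assms subgroup.subset unfolding closed_locally_normal_def by auto

lemma one_in_normalizer: "H \<subseteq> carrier G \<Longrightarrow> \<one> \<in> normalizer G H"
  by (simp add: normalizer_iff conjugate_set_one)

lemma cln_conjugate_set:
  assumes "cln H" "g \<in> carrier G"
  shows "cln (conjugate_set g H)"
  using assms clnD[OF assms(1)] unfolding closed_locally_normal_def
  by (simp add: subgroup_conjugate_set closedin_conjugate_set normalizer_conjugate_set
      openin_conjugate_set)

text \<open>The open subgroup N(H) \<inter> N(K) normalises the intersection, so the normaliser of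
  the intersection is open.\<close>

lemma cln_Int:
  assumes "cln H" "cln K"
  shows "cln (H \<inter> K)"
proof -
  note H = clnD[OF assms(1)] and K = clnD[OF assms(2)]
  have "openin T (normalizer G (H \<inter> K))"
  proof (rule subgroup_openinI)
    show "subgroup (normalizer G (H \<inter> K)) G"
      using H(4) by (intro normalizer_imp_subgroup) auto
    show "openin T (normalizer G H \<inter> normalizer G K)" using H(3) K(3) by (rule openin_Int)
    show "\<one> \<in> normalizer G H \<inter> normalizer G K" using H(4) K(4) by (simp add: one_in_normalizer)
    show "normalizer G H \<inter> normalizer G K \<subseteq> normalizer G (H \<inter> K)"
      using H(4) K(4) by (rule normalizer_Int)
  qed
  then show ?thesis
    using H K unfolding closed_locally_normal_def by (simp add: subgroups_Inter_pair closedin_Int)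
qed

section \<open>The structure lattice in terms of germs\<close>

lemma local_equiv_iff:
  "(H, K) \<in> local_equiv G T \<longleftrightarrow> cln H \<and> cln K \<and> germ_le H K \<and> germ_le K H"
  using openin_subgroup_Int_iff[of H K] openin_subgroup_Int_iff[of K H] clnD(1)
  unfolding local_equiv_def by (auto simp: Int_commute)

lemma equiv_local_equiv: "equiv {H. cln H} (local_equiv G T)"
proof (rule equivI)
  show "local_equiv G T \<subseteq> {H. cln H} \<times> {H. cln H}" by (auto simp: local_equiv_iff)
  show "refl_on {H. cln H} (local_equiv G T)"
    by (auto simp: refl_on_def local_equiv_iff germ_le_subset)
  show "sym_on UNIV (local_equiv G T)" by (auto simp: sym_on_def local_equiv_iff)
  show "trans_on UNIV (local_equiv G T)"
    by (auto simp: trans_on_def local_equiv_iff intro: germ_le_trans)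
qed

text \<open>The class [H] when \<open>H\<close> is closed and locally normal; for any other set it
  is empty.\<close>

definition germ_class :: "'a set \<Rightarrow> 'a set set"
  where "germ_class H = local_equiv G T `` {H}"

lemma mem_germ_class_iff:
  "K \<in> germ_class H \<longleftrightarrow> cln H \<and> cln K \<and> germ_le H K \<and> germ_le K H"
  by (simp add: germ_class_def local_equiv_iff)

lemma self_in_germ_class: "cln H \<Longrightarrow> H \<in> germ_class H"
  by (simp add: mem_germ_class_iff germ_le_subset)

lemma germ_class_eq_iff:
  assumes "cln H" "cln K"
  shows "germ_class H = germ_class K \<longleftrightarrow> germ_le H K \<and> germ_le K H"
  using assms eq_equiv_class_iff[OF equiv_local_equiv, of H K]
  by (simp add: germ_class_def local_equiv_iff)

lemma carrier_structure_lattice: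
  "\<alpha> \<in> carrier (structure_lattice G T) \<longleftrightarrow> (\<exists>H. cln H \<and> \<alpha> = germ_class H)"
  by (auto simp: structure_lattice_def quotient_def germ_class_def)

text \<open>The order asks for representatives with actual containment. When \<open>H\<close> lies
  in \<open>K\<close> only near the identity, \<open>H \<inter> K\<close> is a representative of [H]
  inside \<open>K\<close>.\<close>

lemma structure_lattice_le_iff:
  assumes "cln H" "cln K"
  shows "germ_class H \<sqsubseteq>\<^bsub>structure_lattice G T\<^esub> germ_class K \<longleftrightarrow> germ_le H K"
proof -
  have "(\<exists>A \<in> germ_class H. \<exists>B \<in> germ_class K. A \<subseteq> B) \<longleftrightarrow> germ_le H K"
  proof
    assume "\<exists>A \<in> germ_class H. \<exists>B \<in> germ_class K. A \<subseteq> B"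
    then obtain A B where "A \<in> germ_class H" "B \<in> germ_class K" "A \<subseteq> B" by (elim bexE)
    then show "germ_le H K"
      by (meson mem_germ_class_iff germ_le_subset germ_le_trans)
  next
    assume HK: "germ_le H K"
    have "germ_le H (H \<inter> K)" using HK germ_le_subset[of H H] by (simp add: germ_le_Int)
    then have "H \<inter> K \<in> germ_class H"
      using assms by (simp add: mem_germ_class_iff cln_Int germ_le_subset)
    then show "\<exists>A \<in> germ_class H. \<exists>B \<in> germ_class K. A \<subseteq> B"
      using self_in_germ_class[OF assms(2)] by (intro bexI[of _ "H \<inter> K"] bexI[of _ K]) auto
  qed
  then show ?thesis by (simp add: structure_lattice_def)
qed

text \<open>The lower bounds of [H] and [K] are the classes of germs contained in both, that is, in
  \<open>H \<inter> K\<close>.\<close>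

lemma structure_lattice_meet:
  assumes "cln H" "cln K"
  shows "germ_class H \<sqinter>\<^bsub>structure_lattice G T\<^esub> germ_class K = germ_class (H \<inter> K)"
proof -
  let ?L = "structure_lattice G T"
  let ?Low = "Lower ?L {germ_class H, germ_class K}"
  have HK: "cln (H \<inter> K)" using assms by (rule cln_Int)
  have carrier: "germ_class C \<in> carrier ?L" if "cln C" for C
    using that unfolding carrier_structure_lattice by (intro exI[of _ C]) simp
  have Lower_iff: "germ_class C \<in> ?Low \<longleftrightarrow> germ_le C (H \<inter> K)" if C: "cln C" for C
  proof -
    have "germ_class C \<in> ?Low \<longleftrightarrow> germ_le C H \<and> germ_le C K"
      using C assms carrier by (simp add: Lower_def structure_lattice_le_iff) (auto simp only:)
    then show ?thesis
      using germ_le_Int[of C H K] germ_le_trans[of C "H \<inter> K" H] germ_le_trans[of C "H \<inter> K" K]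
        germ_le_subset[OF Int_lower1, of H K] germ_le_subset[OF Int_lower2, of H K] by argo
  qed
  have Lower_carrier: "\<exists>C. cln C \<and> \<gamma> = germ_class C" if "\<gamma> \<in> ?Low" for \<gamma>
    using that Lower_closed[of ?L] unfolding carrier_structure_lattice[symmetric] by (rule set_mp[rotated])
  have HK_Low: "germ_class (H \<inter> K) \<in> ?Low"
    using Lower_iff[OF HK] germ_le_subset[OF subset_refl] by simp
  have "greatest ?L (germ_class (H \<inter> K)) ?Low"
    unfolding greatest_def
  proof (intro conjI ballI HK_Low Lower_closed)
    fix \<gamma> assume \<gamma>: "\<gamma> \<in> ?Low"
    from Lower_carrier[OF this] obtain C where C: "cln C" "\<gamma> = germ_class C"
      by (elim exE conjE)
    then show "\<gamma> \<sqsubseteq>\<^bsub>?L\<^esub> germ_class (H \<inter> K)"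
      using \<gamma> HK by (simp add: Lower_iff structure_lattice_le_iff)
  qed
  \<comment> \<open>The meet is chosen by \<open>SOME\<close>, so the greatest lower bound must also
    be shown to be unique.\<close>
  moreover have "\<gamma> = germ_class (H \<inter> K)" if g: "greatest ?L \<gamma> ?Low" for \<gamma>
  proof -
    have \<gamma>: "\<gamma> \<in> ?Low" using g by (rule greatest_mem)
    from Lower_carrier[OF this] obtain C where C: "cln C" "\<gamma> = germ_class C"
      by (elim exE conjE)
    have "germ_class (H \<inter> K) \<sqsubseteq>\<^bsub>?L\<^esub> germ_class C"
      using g HK_Low unfolding greatest_def C(2) by simp
    moreover have "germ_le C (H \<inter> K)" using \<gamma> C by (simp add: Lower_iff)
    ultimately show ?thesis using C HK by (simp add: structure_lattice_le_iff germ_class_eq_iff)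
  qed
  ultimately show ?thesis unfolding meet_def inf_def by (rule some_equality)
qed

text \<open>One-sided containment for all elements is enough: the containment for g^-1, conjugated
  by g, is the reverse one.\<close>

lemma conj_class_germ_class_iff:
  assumes "cln H"
  shows "(\<forall>g \<in> carrier G. conj_class G g (germ_class H) = germ_class H) \<longleftrightarrow>
         (\<forall>g \<in> carrier G. germ_le (conjugate_set g H) H)"
proof (intro iffI ballI)
  fix g assume g: "g \<in> carrier G"
    and "\<forall>g \<in> carrier G. conj_class G g (germ_class H) = germ_class H"
  then have "conjugate_set g ` germ_class H = germ_class H"
    by (simp add: conj_class_def conjugate_set_def)
  then have "conjugate_set g H \<in> germ_class H" using self_in_germ_class[OF assms] by auto
  then show "germ_le (conjugate_set g H) H" by (simp add: mem_germ_class_iff)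
next
  fix g assume *: "\<forall>g \<in> carrier G. germ_le (conjugate_set g H) H" and g: "g \<in> carrier G"
  have H: "H \<subseteq> carrier G" using clnD[OF assms] by simp
  have le: "germ_le H (conjugate_set a H)" if a: "a \<in> carrier G" for a
    using germ_le_conjugate_set[of "conjugate_set (inv a) H" H a] * a H
    by (simp add: conjugate_set_cancel conjugate_set_subset)
  \<comment> \<open>\<open>conj_class\<close> moves every member of the class, so all
    representatives \<open>A\<close> have to be followed, not only \<open>H\<close>.\<close>
  have into: "conjugate_set a A \<in> germ_class H" if a: "a \<in> carrier G" and A: "A \<in> germ_class H" for a A
  proof -
    have A': "cln A" "germ_le H A" "germ_le A H" using A by (auto simp: mem_germ_class_iff)
    then have Ac: "A \<subseteq> carrier G" using clnD by simp
    have "germ_le H (conjugate_set a A)"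
      using germ_le_trans[OF le[OF a] germ_le_conjugate_set[OF A'(2) a H Ac]] .
    moreover have "germ_le (conjugate_set a A) H"
      using germ_le_trans[OF germ_le_conjugate_set[OF A'(3) a Ac H]] * a by simp
    ultimately show ?thesis using assms A' a by (simp add: mem_germ_class_iff cln_conjugate_set)
  qed
  have "conjugate_set g ` germ_class H = germ_class H"
  proof (intro equalityI subsetI)
    fix A assume "A \<in> conjugate_set g ` germ_class H"
    then show "A \<in> germ_class H" using into g by auto
  next
    fix A assume A: "A \<in> germ_class H"
    then have "A \<subseteq> carrier G" using clnD(4) by (simp add: mem_germ_class_iff)
    then have "A = conjugate_set g (conjugate_set (inv g) A)"
      using g by (simp add: conjugate_set_cancel)
    moreover have "conjugate_set (inv g) A \<in> germ_class H" using into A g by simp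
    ultimately show "A \<in> conjugate_set g ` germ_class H" by (rule image_eqI)
  qed
  then show "conj_class G g (germ_class H) = germ_class H"
    by (simp add: conj_class_def conjugate_set_def)
qed

lemma LN_fixed_iff:
  assumes "cln H"
  shows "germ_class H \<in> LN_fixed G T \<longleftrightarrow> (\<forall>g \<in> carrier G. germ_le (conjugate_set g H) H)"
  using assms conj_class_germ_class_iff[OF assms] carrier_structure_lattice
  unfolding LN_fixed_def by auto

end


section \<open>Compact open subgroups and quasi-centralisers\<close>

context tdlc_group
begin

text \<open>Connected components are closed, and here the component of \<open>x\<close> is
  \<open>{x}\<close>.\<close>

lemma closedin_singleton:
  assumes "x \<in> carrier G" shows "closedin T {x}"
  using closedin_connected_component_of[of T x] totally_disconnected assms
  by (simp add: totally_disconnected_def topspace_eq)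

lemma Hausdorff: "Hausdorff_space T"
  by (rule Hausdorff_if_closed_one[OF closedin_singleton[OF one_closed]])

text \<open>In a locally compact Hausdorff space a compact component has arbitrarily small clopen
  neighbourhoods. Here the component is \<open>{\<one>}\<close>, and a clopen set inside a compact
  one is compact.\<close>

lemma compact_open_neighbourhood:
  assumes "openin T V" "\<one> \<in> V"
  obtains U where "openin T U" "closedin T U" "compactin T U" "\<one> \<in> U" "U \<subseteq> V"
proof -
  obtain A C where A: "openin T A" "compactin T C" "\<one> \<in> A" "A \<subseteq> C"
    using locally_compact one_closed unfolding locally_compact_space_def topspace_eq
    by (elim ballE exE conjE) auto
  have "{\<one>} \<in> connected_components_of T"
    using connected_component_in_connected_components_of[of T \<one>] totally_disconnected
    by (simp add: totally_disconnected_def topspace_eq)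
  moreover have "compactin T {\<one>}" by (simp add: topspace_eq)
  moreover have "openin T (V \<inter> A)" using assms(1) A(1) by (rule openin_Int)
  moreover have "{\<one>} \<subseteq> V \<inter> A" using assms A by simp
  ultimately obtain U W where U: "openin T U" "openin T W" "disjnt U W" "U \<union> W = topspace T"
      "{\<one>} \<subseteq> U" "U \<subseteq> V \<inter> A"
    by (rule wilder_locally_compact_component_thm[OF locally_compact Hausdorff])
  have "topspace T - U = W" using U(3,4) by (auto simp: disjnt_iff)
  then have cl: "closedin T U" using U(1,2) openin_subset[OF U(1)] by (simp add: closedin_def)
  moreover have "compactin T U"
    by (rule closed_compactin[OF A(2) _ cl]) (use U(6) A(4) in auto)
  ultimately show thesis using U by (intro that[of U]) auto
qed

text \<open>The subgroup is the right stabiliser of a compact open neighbourhood \<open>U\<close>.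
  The tube lemma makes it open, and it lies in \<open>U\<close> because \<open>U\<close> contains
  the identity.\<close>

theorem van_Dantzig:
  assumes "openin T V" "\<one> \<in> V"
  obtains S where "subgroup S G" "openin T S" "compactin T S" "S \<subseteq> V"
proof -
  obtain U where U: "openin T U" "closedin T U" "compactin T U" "\<one> \<in> U" "U \<subseteq> V"
    using assms by (rule compact_open_neighbourhood)
  have Uc: "U \<subseteq> carrier G" using U(1) by (rule openin_carrier)
  let ?P = "{z \<in> topspace (prod_topology T T). (case z of (x, y) \<Rightarrow> x \<otimes> y) \<in> U}"
  \<comment> \<open>Multiplication sends \<open>U \<times> {\<one>}\<close> into \<open>U\<close>,
    so compactness gives a neighbourhood \<open>W\<close> of the identity with U W \<subseteq>
    U.\<close>
  have "\<exists>X W. openin T X \<and> openin T W \<and> U \<subseteq> X \<and> \<one> \<in> W \<and> X \<times> W \<subseteq> ?P"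
  proof (rule tube_lemma_left)
    show "openin (prod_topology T T) ?P"
      using continuous_mult U(1) by (rule openin_continuous_map_preimage)
    show "compactin T U" by (rule U(3))
    show "U \<times> {\<one>} \<subseteq> ?P" using Uc by (auto simp: topspace_eq)
  qed (simp add: topspace_eq)
  then obtain X W where W: "openin T W" "U \<subseteq> X" "\<one> \<in> W" "X \<times> W \<subseteq> ?P" by (elim exE conjE)
  have Wc: "W \<subseteq> carrier G" using W(1) by (rule openin_carrier)
  have UW: "u \<otimes> w \<in> U" if "u \<in> U" "w \<in> W" for u w
    using that W(2,4) by (auto dest!: subsetD)
  \<comment> \<open>The two conditions together say U g = U, which is symmetric in \<open>g\<close>
    and its inverse.\<close>
  define S where "S = {g \<in> carrier G. \<forall>u \<in> U. u \<otimes> g \<in> U \<and> u \<otimes> inv g \<in> U}"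
  have S: "subgroup S G"
  proof (rule subgroupI)
    show "S \<subseteq> carrier G" by (auto simp: S_def)
    have "\<one> \<in> S" using Uc by (auto simp: S_def)
    then show "S \<noteq> {}" by auto
  next
    fix a assume "a \<in> S"
    then show "inv a \<in> S" by (simp add: S_def)
  next
    fix a b assume ab: "a \<in> S" "b \<in> S"
    have "u \<otimes> (a \<otimes> b) \<in> U \<and> u \<otimes> inv (a \<otimes> b) \<in> U" if u: "u \<in> U" for u
    proof -
      have c: "u \<in> carrier G" "a \<in> carrier G" "b \<in> carrier G" using u Uc ab by (auto simp: S_def)
      have "u \<otimes> a \<otimes> b \<in> U" "u \<otimes> inv b \<otimes> inv a \<in> U" using u ab by (auto simp: S_def)
      then show ?thesis using c by (simp add: m_assoc inv_mult_group)
    qed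
    then show "a \<otimes> b \<in> S" using ab by (simp add: S_def)
  qed
  let ?W = "W \<inter> {x \<in> carrier G. inv x \<in> W}"
  have "openin T ?W"
    by (intro openin_Int W(1) openin_preimage continuous_intros)
  moreover have "\<one> \<in> ?W" using W by simp
  moreover have "?W \<subseteq> S" using UW by (auto simp: S_def)
  ultimately have open_S: "openin T S" by (rule subgroup_openinI[OF S])
  have "S \<subseteq> U"
  proof
    fix s assume "s \<in> S"
    then have "\<one> \<otimes> s \<in> U" "s \<in> carrier G" using U(4) by (auto simp: S_def)
    then show "s \<in> U" by simp
  qed
  then have "compactin T S" "S \<subseteq> V"
    using closed_compactin[OF U(3) _ open_subgroup_closedin[OF S open_S]] U(5) by auto
  then show thesis using that S open_S by auto
qed

section \<open>Quasi-centralisers\<close>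

abbreviation QC :: "'a set \<Rightarrow> 'a set"
  where "QC K \<equiv> quasi_centraliser_in G T (carrier G) K"

text \<open>By \<open>van_Dantzig\<close> every open neighbourhood of the identity contains a
  compact open subgroup, so testing on arbitrary neighbourhoods gives the same set.\<close>

lemma mem_QC_iff:
  "x \<in> QC K \<longleftrightarrow> x \<in> carrier G \<and> (\<exists>V. openin T V \<and> \<one> \<in> V \<and> (\<forall>k \<in> K \<inter> V. x \<otimes> k = k \<otimes> x))"
proof
  assume "x \<in> QC K"
  then obtain U where U: "subgroup U G" "openin T U" "x \<in> carrier G" "\<forall>k \<in> K \<inter> U. x \<otimes> k = k \<otimes> x"
    by (auto simp: quasi_centraliser_in_def centraliser_in_def)
  then show "x \<in> carrier G \<and> (\<exists>V. openin T V \<and> \<one> \<in> V \<and> (\<forall>k \<in> K \<inter> V. x \<otimes> k = k \<otimes> x))"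
    using subgroup.one_closed[OF U(1)] by (intro conjI exI[of _ U]) 
next
  assume *: "x \<in> carrier G \<and> (\<exists>V. openin T V \<and> \<one> \<in> V \<and> (\<forall>k \<in> K \<inter> V. x \<otimes> k = k \<otimes> x))"
  then obtain V where V: "openin T V" "\<one> \<in> V" "\<forall>k \<in> K \<inter> V. x \<otimes> k = k \<otimes> x" by (elim exE conjE)
  obtain U where U: "subgroup U G" "openin T U" "compactin T U" "U \<subseteq> V"
    using van_Dantzig[OF V(1,2)] .
  have "x \<in> centr (K \<inter> U)" using * V(3) U(4) by (auto simp: centraliser_in_def)
  then show "x \<in> QC K" unfolding quasi_centraliser_in_def using U by (intro UN_I[of U]) simp_all
qed

lemma mem_QC_I:
  "x \<in> carrier G \<Longrightarrow> openin T V \<Longrightarrow> \<one> \<in> V \<Longrightarrow> (\<And>k. k \<in> K \<Longrightarrow> k \<in> V \<Longrightarrow> x \<otimes> k = k \<otimes> x) \<Longrightarrow> x \<in> QC K"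
  unfolding mem_QC_iff by (intro conjI exI[of _ V]) auto

lemma mem_QC_E:
  assumes "x \<in> QC K"
  obtains V where "x \<in> carrier G" "openin T V" "\<one> \<in> V" "\<And>k. k \<in> K \<Longrightarrow> k \<in> V \<Longrightarrow> x \<otimes> k = k \<otimes> x"
proof -
  from assms have "x \<in> carrier G" "\<exists>V. openin T V \<and> \<one> \<in> V \<and> (\<forall>k \<in> K \<inter> V. x \<otimes> k = k \<otimes> x)"
    by (simp_all add: mem_QC_iff)
  then show thesis using that by auto
qed

text \<open>Commuting is tested only near the identity; hence \<open>QC\<close> depends only on the
  germ of its argument.\<close>

lemma QC_antimono:
  assumes "germ_le A B" shows "QC B \<subseteq> QC A"
proof
  fix x assume "x \<in> QC B"
  then obtain V where V: "x \<in> carrier G" "openin T V" "\<one> \<in> V"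
    "\<And>k. k \<in> B \<Longrightarrow> k \<in> V \<Longrightarrow> x \<otimes> k = k \<otimes> x" by (rule mem_QC_E) auto
  obtain W where W: "openin T W" "\<one> \<in> W" "A \<inter> W \<subseteq> B" using assms by (rule germ_leE)
  show "x \<in> QC A"
    by (rule mem_QC_I[OF V(1) openin_Int[OF V(2) W(1)]]) (use V W in auto)
qed

lemma subgroup_QC:
  assumes K: "K \<subseteq> carrier G"
  shows "subgroup (QC K) G"
proof (rule subgroupI)
  show "QC K \<subseteq> carrier G" by (auto simp: mem_QC_iff)
  have "\<one> \<in> QC K" by (rule mem_QC_I[OF one_closed openin_whole]) (use K in auto)
  then show "QC K \<noteq> {}" by auto
next
  fix a assume "a \<in> QC K"
  then obtain V where V: "a \<in> carrier G" "openin T V" "\<one> \<in> V"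
    "\<And>k. k \<in> K \<Longrightarrow> k \<in> V \<Longrightarrow> a \<otimes> k = k \<otimes> a" by (rule mem_QC_E) auto
  show "inv a \<in> QC K"
    by (rule mem_QC_I[OF inv_closed[OF V(1)] V(2,3)]) (use V K in \<open>auto simp: commute_inv\<close>)
next
  fix a b assume "a \<in> QC K" "b \<in> QC K"
  obtain V where V: "a \<in> carrier G" "openin T V" "\<one> \<in> V"
    "\<And>k. k \<in> K \<Longrightarrow> k \<in> V \<Longrightarrow> a \<otimes> k = k \<otimes> a" using \<open>a \<in> QC K\<close> by (rule mem_QC_E) auto
  obtain W where W: "b \<in> carrier G" "openin T W" "\<one> \<in> W"
    "\<And>k. k \<in> K \<Longrightarrow> k \<in> W \<Longrightarrow> b \<otimes> k = k \<otimes> b" using \<open>b \<in> QC K\<close> by (rule mem_QC_E) auto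
  show "a \<otimes> b \<in> QC K"
    by (rule mem_QC_I[OF m_closed[OF V(1) W(1)] openin_Int[OF V(2) W(2)]])
      (use V W K in \<open>auto intro!: commute_mult\<close>)
qed

text \<open>The neighbourhood on which \<open>x\<close> commutes with \<open>K\<close>, conjugated
  by \<open>g\<close>, serves for the conjugates.\<close>

lemma conj_mem_QC:
  assumes x: "x \<in> QC K" and g: "g \<in> carrier G" and K: "K \<subseteq> carrier G"
  shows "g \<otimes> x \<otimes> inv g \<in> QC (conjugate_set g K)"
proof -
  obtain V where V: "x \<in> carrier G" "openin T V" "\<one> \<in> V"
    "\<And>k. k \<in> K \<Longrightarrow> k \<in> V \<Longrightarrow> x \<otimes> k = k \<otimes> x" using x by (rule mem_QC_E) auto
  have Vc: "V \<subseteq> carrier G" using V(2) by (rule openin_carrier)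
  show ?thesis
  proof (rule mem_QC_I)
    show "openin T (conjugate_set g V)" by (rule openin_conjugate_set[OF g V(2)])
    fix k assume "k \<in> conjugate_set g K" "k \<in> conjugate_set g V"
    then have k: "k \<in> carrier G" "inv g \<otimes> k \<otimes> g \<in> K" "inv g \<otimes> k \<otimes> g \<in> V"
      using g K Vc by (simp_all add: conjugate_set_iff)
    show "(g \<otimes> x \<otimes> inv g) \<otimes> k = k \<otimes> (g \<otimes> x \<otimes> inv g)"
      by (rule commute_conj[OF g V(1) k(1) V(4)[OF k(2,3)]])
  qed (use g V Vc in \<open>simp_all add: conjugate_set_iff\<close>)
qed

text \<open>A conjugate of an element of QC(H) commutes with g H g^-1 near the identity, and there g
  H g^-1 contains \<open>H\<close>.\<close>

lemma normal_QC:
  assumes "H \<subseteq> carrier G" "\<And>g. g \<in> carrier G \<Longrightarrow> germ_le H (conjugate_set g H)"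
  shows "QC H \<lhd> G"
proof (rule normal_invI)
  show "subgroup (QC H) G" using assms(1) by (rule subgroup_QC)
  fix g x assume "g \<in> carrier G" "x \<in> QC H"
  then show "g \<otimes> x \<otimes> inv g \<in> QC H"
    using conj_mem_QC[OF _ _ assms(1)] QC_antimono[OF assms(2)] by (auto dest: subsetD)
qed

text \<open>Centralising a single \<open>k\<close> means that the continuous map x -> x k x^-1 takes
  a value in the closed set \<open>{k}\<close>.\<close>

lemma closedin_centr:
  assumes K: "K \<subseteq> carrier G"
  shows "closedin T (centr K)"
proof -
  have "closedin T {x \<in> carrier G. x \<otimes> k \<otimes> inv x \<in> {k}}" if "k \<in> K" for k
    using that K closedin_singleton by (intro closedin_preimage continuous_intros) auto
  \<comment> \<open>Intersecting with the whole space gives the right value when \<open>K\<close> is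
    empty.\<close>
  then have "closedin T (topspace T \<inter> (\<Inter>k \<in> K. {x \<in> carrier G. x \<otimes> k \<otimes> inv x \<in> {k}}))"
    by (cases "K = {}") (auto intro!: closedin_Int closedin_INT)
  moreover have "topspace T \<inter> (\<Inter>k \<in> K. {x \<in> carrier G. x \<otimes> k \<otimes> inv x \<in> {k}}) = centr K"
    using K by (auto simp: centraliser_in_def topspace_eq commute_iff_conj subset_iff)
  ultimately show ?thesis by simp
qed

section \<open>Discrete subgroups\<close>

lemma discrete_in_one_isolated:
  assumes "discrete_in T D" "\<one> \<in> D"
  obtains V where "openin T V" "\<one> \<in> V" "D \<inter> V = {\<one>}"
proof -
  have "openin (subtopology T D) {\<one>}" using assms by (simp add: discrete_in_def)
  then obtain V where "openin T V" "{\<one>} = V \<inter> D"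
    unfolding openin_subtopology by (elim exE conjE)
  then show thesis using that[of V] by (auto simp: Int_commute)
qed

text \<open>If an open subgroup \<open>U\<close> meets \<open>D\<close> only in the identity, each
  left coset of \<open>U\<close> contains at most one point of \<open>D\<close>: for two points a
  and b, the quotient a^-1 b lies in \<open>D \<inter> U\<close>.\<close>

lemma discrete_subgroup_closedin:
  assumes D: "subgroup D G" "discrete_in T D"
  shows "closedin T D"
proof -
  obtain V where V: "openin T V" "\<one> \<in> V" "D \<inter> V = {\<one>}"
    using D by (metis discrete_in_one_isolated subgroup.one_closed)
  obtain U where U: "subgroup U G" "openin T U" "compactin T U" "U \<subseteq> V"
    using van_Dantzig[OF V(1,2)] .
  have Dc: "D \<subseteq> carrier G" using D(1) by (rule subgroup.subset)
  have "openin T (carrier G - D)"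
  proof (subst openin_subopen, rule ballI)
    fix x assume x: "x \<in> carrier G - D"
    let ?W = "{y \<in> carrier G. inv x \<otimes> y \<in> U}"
    have W: "openin T ?W" using x U by (intro openin_preimage continuous_intros) auto
    have xW: "x \<in> ?W" using x by (simp add: subgroup.one_closed[OF U(1)])
    have unique: "a = b" if "a \<in> ?W \<inter> D" "b \<in> ?W \<inter> D" for a b
    proof -
      have c: "a \<in> carrier G" "b \<in> carrier G" using that by auto
      have "inv (inv x \<otimes> a) \<otimes> (inv x \<otimes> b) \<in> U"
        using that by (simp add: subgroup.m_closed[OF U(1)] subgroup.m_inv_closed[OF U(1)])
      moreover have "inv (inv x \<otimes> a) \<otimes> (inv x \<otimes> b) = inv a \<otimes> b"
        using c x by (simp add: inv_mult_group m_assoc) (simp add: m_assoc[symmetric])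
      ultimately have "inv a \<otimes> b \<in> D \<inter> V"
        using that U(4) by (auto simp: subgroup.m_closed[OF D(1)] subgroup.m_inv_closed[OF D(1)])
      then have "inv a \<otimes> b = \<one>" using V(3) by simp
      then show "a = b" using c by (metis inv_closed inv_equality inv_inv)
    qed
    \<comment> \<open>At most one point is removed from the coset, and points are closed.\<close>
    have "openin T (?W - ?W \<inter> D)"
    proof (cases "?W \<inter> D = {}")
      case True
      then show ?thesis using W by simp
    next
      case False
      then obtain d where d: "d \<in> ?W \<inter> D" by auto
      then have "?W \<inter> D = {d}" using unique by (intro equalityI subsetI) auto
      then show ?thesis using W closedin_singleton[of d] Dc d by (auto intro!: openin_diff)
    qed
    moreover have "x \<in> ?W - ?W \<inter> D" using x xW by simp
    moreover have "?W - ?W \<inter> D \<subseteq> carrier G - D" by auto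
    ultimately show "\<exists>W. openin T W \<and> x \<in> W \<and> W \<subseteq> carrier G - D" by (intro exI conjI)
  qed
  then show ?thesis using Dc by (simp add: closedin_def topspace_eq)
qed


section \<open>The fixed points of the structure lattice\<close>

lemma LN_zero_eq: "LN_zero G T = germ_class {\<one>}"
  by (simp add: LN_zero_def germ_class_def)

lemma cln_one: "cln {\<one>}"
proof -
  have "normalizer G {\<one>} = carrier G"
    by (auto simp: normalizer_iff conjugate_set_def l_coset_def r_coset_def)
  then show ?thesis
    unfolding closed_locally_normal_def
    using triv_subgroup closedin_singleton[OF one_closed] openin_whole by simp
qed

lemma germ_class_eq_zero_iff:
  assumes "cln H" shows "germ_class H = LN_zero G T \<longleftrightarrow> germ_le H {\<one>}"
  using germ_class_eq_iff[OF assms cln_one] germ_le_subset[of "{\<one>}" H] clnD(1)[OF assms]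
  by (auto simp: LN_zero_eq subgroup.one_closed)

text \<open>This translation lets both closure properties be proved on representatives, as
  statements about germs.\<close>

lemma LN_fixed_nonzero_iff:
  "\<alpha> \<in> LN_fixed G T - {LN_zero G T} \<longleftrightarrow>
    (\<exists>H. \<alpha> = germ_class H \<and> cln H \<and> (\<forall>g \<in> carrier G. germ_le (conjugate_set g H) H) \<and> \<not> germ_le H {\<one>})"
proof
  assume \<alpha>: "\<alpha> \<in> LN_fixed G T - {LN_zero G T}"
  then have "\<alpha> \<in> carrier (structure_lattice G T)" by (simp add: LN_fixed_def)
  then obtain H where "cln H" "\<alpha> = germ_class H"
    unfolding carrier_structure_lattice by (elim exE conjE)
  with \<alpha> show "\<exists>H. \<alpha> = germ_class H \<and> cln H \<and>
      (\<forall>g \<in> carrier G. germ_le (conjugate_set g H) H) \<and> \<not> germ_le H {\<one>}"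
    by (intro exI[of _ H]) (simp add: LN_fixed_iff germ_class_eq_zero_iff)
next
  assume "\<exists>H. \<alpha> = germ_class H \<and> cln H \<and>
      (\<forall>g \<in> carrier G. germ_le (conjugate_set g H) H) \<and> \<not> germ_le H {\<one>}"
  then show "\<alpha> \<in> LN_fixed G T - {LN_zero G T}"
    by (elim exE conjE) (simp add: LN_fixed_iff germ_class_eq_zero_iff)
qed

section \<open>Stabilisers of classes and the upper subset property\<close>

definition germ_stabiliser :: "'a set \<Rightarrow> 'a set"
  where "germ_stabiliser K =
    {g \<in> carrier G. germ_le (conjugate_set g K) K \<and> germ_le (conjugate_set (inv g) K) K}"

text \<open>Inverses come from the symmetric form of the definition. For a product, the containment
  for \<open>b\<close> is conjugated by \<open>a\<close> and composed with the one for
  \<open>a\<close>.\<close>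

lemma subgroup_germ_stabiliser:
  assumes K: "K \<subseteq> carrier G"
  shows "subgroup (germ_stabiliser K) G"
proof (rule subgroupI)
  show "germ_stabiliser K \<subseteq> carrier G" by (auto simp: germ_stabiliser_def)
  have "\<one> \<in> germ_stabiliser K"
    using K by (simp add: germ_stabiliser_def conjugate_set_one[OF K, simplified] germ_le_subset)
  then show "germ_stabiliser K \<noteq> {}" by auto
next
  fix a assume "a \<in> germ_stabiliser K"
  then show "inv a \<in> germ_stabiliser K" by (simp add: germ_stabiliser_def)
next
  have *: "germ_le (conjugate_set (a \<otimes> b) K) K"
    if "a \<in> carrier G" "b \<in> carrier G" "germ_le (conjugate_set a K) K"
      "germ_le (conjugate_set b K) K" for a b
    using germ_le_trans[OF germ_le_conjugate_set[OF that(4,1)] that(3)] that K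
    by (simp add: conjugate_set_conjugate_set conjugate_set_subset)
  fix a b assume "a \<in> germ_stabiliser K" "b \<in> germ_stabiliser K"
  then show "a \<otimes> b \<in> germ_stabiliser K"
    using *[of a b] *[of "inv b" "inv a"] by (simp add: germ_stabiliser_def inv_mult_group)
qed

lemma openin_germ_stabiliser:
  assumes "cln K" shows "openin T (germ_stabiliser K)"
proof (rule subgroup_openinI)
  note K = clnD[OF assms]
  show "subgroup (germ_stabiliser K) G" by (rule subgroup_germ_stabiliser[OF K(4)])
  show "openin T (normalizer G K)" by (rule K(3))
  show "\<one> \<in> normalizer G K" by (rule one_in_normalizer[OF K(4)])
  show "normalizer G K \<subseteq> germ_stabiliser K"
  proof
    fix g assume g: "g \<in> normalizer G K"
    then have "inv g \<in> normalizer G K"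
      by (rule subgroup.m_inv_closed[OF normalizer_imp_subgroup[OF K(4)]])
    with g show "g \<in> germ_stabiliser K"
      using K(4) by (simp add: normalizer_iff germ_stabiliser_def germ_le_subset)
  qed
qed

text \<open>For y = g k g^-1 with \<open>k\<close> in \<open>K\<close>, write y = k (k^-1 y). If y
  is close to the identity, then k normalises \<open>L\<close>, so k^-1 y = (k^-1 g k) g^-1 lies in
  \<open>L\<close>, and being close to the identity it lies in \<open>K\<close>.\<close>

lemma germ_le_conjugate_if_mem:
  assumes L: "cln L" and LK: "germ_le L K" and K: "subgroup K G" and g: "g \<in> L"
  shows "germ_le (conjugate_set g K) K"
proof -
  note L' = clnD[OF L]
  have gc: "g \<in> carrier G" using g L'(4) by auto
  have Kc: "K \<subseteq> carrier G" by (rule subgroup.subset[OF K])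
  obtain V where V: "openin T V" "\<one> \<in> V" "L \<inter> V \<subseteq> K" using LK by (rule germ_leE)
  \<comment> \<open>With k = g^-1 y g, membership of y in \<open>?N\<close> says that k normalises
    \<open>L\<close>, and membership in \<open>?W\<close> that k^-1 y lies in \<open>V\<close>,
    where \<open>L\<close> is contained in \<open>K\<close>.\<close>
  let ?N = "{y \<in> carrier G. inv g \<otimes> y \<otimes> g \<in> normalizer G L}"
  let ?W = "{y \<in> carrier G. inv (inv g \<otimes> y \<otimes> g) \<otimes> y \<in> V}"
  show ?thesis
  proof (rule germ_leI)
    have "openin T ?N"
      using gc L'(3) by (intro openin_preimage continuous_intros) auto
    moreover have "openin T ?W"
      using gc V(1) by (intro openin_preimage continuous_intros) auto
    ultimately show "openin T (?N \<inter> ?W)" by (rule openin_Int)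
    show "\<one> \<in> ?N \<inter> ?W" using gc V(2) one_in_normalizer[OF L'(4)] by simp
    show "conjugate_set g K \<inter> (?N \<inter> ?W) \<subseteq> K"
    proof
      fix y assume "y \<in> conjugate_set g K \<inter> (?N \<inter> ?W)"
      then have y: "y \<in> carrier G" "inv g \<otimes> y \<otimes> g \<in> K" "inv g \<otimes> y \<otimes> g \<in> normalizer G L"
          "inv (inv g \<otimes> y \<otimes> g) \<otimes> y \<in> V"
        using gc Kc by (simp_all add: conjugate_set_iff)
      define k where "k = inv g \<otimes> y \<otimes> g"
      have kc: "k \<in> carrier G" using gc y by (simp add: k_def)
      have "inv k \<in> normalizer G L"
        using y(3) subgroup.m_inv_closed[OF normalizer_imp_subgroup[OF L'(4)]] by (simp add: k_def)
      then have "inv k \<otimes> g \<otimes> inv (inv k) \<in> L" by (rule normalizer_conj_closed[OF L'(4) _ g])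
      then have "inv k \<otimes> g \<otimes> k \<otimes> inv g \<in> L"
        using g kc by (simp add: subgroup.m_closed[OF L'(1)] subgroup.m_inv_closed[OF L'(1)])
      moreover have eq: "y = g \<otimes> k \<otimes> inv g"
        using gc y by (simp add: k_def m_assoc) (simp add: m_assoc[symmetric])
      ultimately have "inv k \<otimes> y \<in> L" using gc kc by (simp add: m_assoc)
      then have "inv k \<otimes> y \<in> K" using y(4) V(3) by (auto simp: k_def)
      then have "k \<otimes> (inv k \<otimes> y) \<in> K" using y(2) by (simp add: subgroup.m_closed[OF K] k_def)
      then show "y \<in> K" using y(1) kc by (simp add: m_assoc[symmetric])
    qed
  qed
qed

text \<open>Every conjugate of \<open>H\<close> is contained in \<open>K\<close> near the identity
  and hence lies in the stabiliser of [K]. The normal core of the stabiliser is therefore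
  nontrivial, and simplicity applies to it.\<close>

lemma germ_stabiliser_eq_carrier:
  assumes simple: "topologically_simple G T"
    and H: "cln H" "\<And>g. g \<in> carrier G \<Longrightarrow> germ_le (conjugate_set g H) H" "H \<noteq> {\<one>}"
    and K: "cln K" "germ_le H K"
  shows "germ_stabiliser K = carrier G"
proof -
  note H' = clnD[OF H(1)] and K' = clnD[OF K(1)]
  let ?S = "germ_stabiliser K"
  have S: "subgroup ?S G" by (rule subgroup_germ_stabiliser[OF K'(4)])
  have Sc: "?S \<subseteq> carrier G" by (rule subgroup.subset[OF S])
  have "closedin T ?S" by (rule open_subgroup_closedin[OF S openin_germ_stabiliser[OF K(1)]])
  have conj_S: "conjugate_set x H \<subseteq> ?S" if x: "x \<in> carrier G" for x
  proof
    fix g assume g: "g \<in> conjugate_set x H"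
    have L: "cln (conjugate_set x H)" "germ_le (conjugate_set x H) K"
      using cln_conjugate_set[OF H(1) x] germ_le_trans[OF H(2)[OF x] K(2)] by simp_all
    \<comment> \<open>Membership in \<open>germ_stabiliser\<close> needs the containment for
      \<open>g\<close> and for its inverse; both are elements of the same conjugate.\<close>
    have "inv g \<in> conjugate_set x H" using g by (rule subgroup.m_inv_closed[OF clnD(1)[OF L(1)]])
    then show "g \<in> ?S"
      using germ_le_conjugate_if_mem[OF L K'(1)] g conjugate_set_subset[OF x H'(4)]
      by (auto simp: germ_stabiliser_def)
  qed
  \<comment> \<open>The normal core of the stabiliser, closed because each conjugate of the
    stabiliser is closed.\<close>
  define N where "N = (\<Inter>x \<in> carrier G. conjugate_set x ?S)"
  have "carrier G \<noteq> {}" using one_closed by auto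
  have N_iff: "y \<in> N \<longleftrightarrow> y \<in> carrier G \<and> (\<forall>x \<in> carrier G. inv x \<otimes> y \<otimes> x \<in> ?S)" for y
    using Sc one_closed by (auto simp: N_def conjugate_set_iff)
  have "closedin T N"
    unfolding N_def using \<open>carrier G \<noteq> {}\<close> \<open>closedin T ?S\<close>
    by (intro closedin_INT closedin_conjugate_set)
  have "subgroup N G"
    unfolding N_def using \<open>carrier G \<noteq> {}\<close> subgroup_conjugate_set[OF S]
    by (intro subgroups_Inter) auto
  have "N \<lhd> G"
  proof (rule normal_invI[OF \<open>subgroup N G\<close>])
    fix x h assume x: "x \<in> carrier G" and h: "h \<in> N"
    have hc: "h \<in> carrier G" using h by (simp add: N_iff)
    have "inv y \<otimes> (x \<otimes> h \<otimes> inv x) \<otimes> y \<in> ?S" if y: "y \<in> carrier G" for y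
    proof -
      have "inv (inv x \<otimes> y) \<otimes> h \<otimes> (inv x \<otimes> y) \<in> ?S" using h x y by (simp add: N_iff)
      then show ?thesis using x y hc by (simp add: inv_mult_group m_assoc)
    qed
    then show "x \<otimes> h \<otimes> inv x \<in> N" using x hc by (simp add: N_iff)
  qed
  have "H \<subseteq> N"
  proof
    fix h assume h: "h \<in> H"
    then have hc: "h \<in> carrier G" using H'(4) by auto
    have "inv x \<otimes> h \<otimes> x \<in> ?S" if x: "x \<in> carrier G" for x
    proof -
      have "inv x \<otimes> h \<otimes> inv (inv x) \<in> conjugate_set (inv x) H"
        unfolding conjugate_set_def l_coset_def r_coset_def using h by blast
      then show ?thesis using conj_S[of "inv x"] x by auto
    qed
    then show "h \<in> N" using hc by (simp add: N_iff)
  qed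
  moreover have "\<one> \<in> H" by (rule subgroup.one_closed[OF H'(1)])
  ultimately have "N \<noteq> {\<one>}" using H(3) by auto
  then have "N = carrier G"
    using simple \<open>N \<lhd> G\<close> \<open>closedin T N\<close> unfolding topologically_simple_def by auto
  moreover have "N \<subseteq> ?S"
  proof
    fix y assume "y \<in> N"
    then have "inv \<one> \<otimes> y \<otimes> \<one> \<in> ?S" "y \<in> carrier G" using N_iff[of y] one_closed by auto
    then show "y \<in> ?S" by simp
  qed
  ultimately show ?thesis using Sc by auto
qed

lemma upper_subset_LN_fixed:
  assumes simple: "topologically_simple G T"
  shows "upper_subset (structure_lattice G T) (LN_fixed G T - {LN_zero G T})"
  unfolding upper_subset_def
proof (intro conjI ballI impI)
  show "LN_fixed G T - {LN_zero G T} \<subseteq> carrier (structure_lattice G T)"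
    by (auto simp: LN_fixed_def)
next
  fix \<alpha> \<beta>
  assume "\<alpha> \<in> LN_fixed G T - {LN_zero G T}" "\<beta> \<in> carrier (structure_lattice G T)"
    and le: "\<alpha> \<sqsubseteq>\<^bsub>structure_lattice G T\<^esub> \<beta>"
  then obtain H K where H: "\<alpha> = germ_class H" "cln H"
      "\<forall>g \<in> carrier G. germ_le (conjugate_set g H) H" "\<not> germ_le H {\<one>}"
      and K: "cln K" "\<beta> = germ_class K"
    unfolding LN_fixed_nonzero_iff carrier_structure_lattice by (elim exE conjE)
  have HK: "germ_le H K" using le H K by (simp add: structure_lattice_le_iff)
  have "H \<noteq> {\<one>}" using H(4) germ_le_subset by auto
  then have "germ_stabiliser K = carrier G"
    using germ_stabiliser_eq_carrier[OF simple H(2) _ _ K(1) HK] H(3) by simp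
  then have "\<forall>g \<in> carrier G. germ_le (conjugate_set g K) K" by (auto simp: germ_stabiliser_def)
  moreover have "\<not> germ_le K {\<one>}" using H(4) germ_le_trans[OF HK] by auto
  ultimately show "\<beta> \<in> LN_fixed G T - {LN_zero G T}"
    unfolding LN_fixed_nonzero_iff using K by (intro exI[of _ K]) simp
qed

section \<open>Quasi-centralisers under C-stability, and meets\<close>

lemma QC_carrier_eq: "quasi_centre G T = QC (carrier G)"
  by (simp add: quasi_centre_def)

text \<open>For fixed \<open>d\<close> the commutator of n and \<open>d\<close> depends continuously
  on n and stays in \<open>D\<close> for n in \<open>N\<close>. As the identity is isolated in
  \<open>D\<close>, the commutator is trivial for n near the identity, so \<open>d\<close> is in the
  quasi-centre.\<close>

lemma discrete_trivial_if_quasi_centre_trivial: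
  assumes D: "subgroup D G" "discrete_in T D"
    and N: "subgroup N G" "openin T N" "\<And>n d. n \<in> N \<Longrightarrow> d \<in> D \<Longrightarrow> n \<otimes> d \<otimes> inv n \<in> D"
    and QZ: "quasi_centre G T = {\<one>}"
  shows "D = {\<one>}"
proof -
  obtain V where V: "openin T V" "\<one> \<in> V" "D \<inter> V = {\<one>}"
    using D by (metis discrete_in_one_isolated subgroup.one_closed)
  have "d = \<one>" if d: "d \<in> D" for d
  proof -
    have dc: "d \<in> carrier G" using subgroup.mem_carrier[OF D(1) d] .
    let ?W = "{n \<in> carrier G. n \<otimes> d \<otimes> inv n \<otimes> inv d \<in> V}"
    have "d \<in> QC (carrier G)"
    proof (rule mem_QC_I[OF dc])
      have "openin T ?W" using dc V(1) by (intro openin_preimage continuous_intros) auto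
      then show "openin T (N \<inter> ?W)" by (rule openin_Int[OF N(2)])
      show "\<one> \<in> N \<inter> ?W" using dc V(2) by (simp add: subgroup.one_closed[OF N(1)])
      fix n assume n: "n \<in> carrier G" "n \<in> N \<inter> ?W"
      have "n \<otimes> d \<otimes> inv n \<otimes> inv d \<in> D"
        using n d N(3) by (simp add: subgroup.m_closed[OF D(1)] subgroup.m_inv_closed[OF D(1)])
      then have "n \<otimes> d \<otimes> inv n \<otimes> inv d \<in> D \<inter> V" using n by simp
      then have "n \<otimes> d \<otimes> inv n \<otimes> inv d = \<one>" unfolding V(3) by simp
      then show "d \<otimes> n = n \<otimes> d" by (rule commute_if_commutator_one[OF n(1) dc, symmetric])
    qed
    then show ?thesis using QZ by (simp add: QC_carrier_eq)
  qed
  then show ?thesis using subgroup.one_closed[OF D(1)] by blast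
qed

text \<open>C-stability makes the intersection discrete. The open subgroup N(H) normalises
  \<open>H\<close>, hence C(H), hence both quasi-centralisers.\<close>

lemma QC_Int_QC_centr_trivial:
  assumes "cln H" "C_stable G T H" "quasi_centre G T = {\<one>}"
  shows "QC H \<inter> QC (centr H) = {\<one>}"
proof (rule discrete_trivial_if_quasi_centre_trivial)
  note H = clnD[OF assms(1)]
  have C: "centr H \<subseteq> carrier G" by (rule subgroup.subset[OF subgroup_centr[OF H(4)]])
  show "subgroup (QC H \<inter> QC (centr H)) G"
    using subgroup_QC[OF H(4)] subgroup_QC[OF C] by (rule subgroups_Inter_pair)
  show "discrete_in T (QC H \<inter> QC (centr H))" using assms(2) by (simp add: C_stable_def)
  show "subgroup (normalizer G H) G" by (rule normalizer_imp_subgroup[OF H(4)])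
  show "openin T (normalizer G H)" by (rule H(3))
  show "quasi_centre G T = {\<one>}" by (rule assms(3))
  fix n d assume n: "n \<in> normalizer G H" and d: "d \<in> QC H \<inter> QC (centr H)"
  have nc: "n \<in> carrier G" "conjugate_set n H = H" using n H(4) by (simp_all add: normalizer_iff)
  \<comment> \<open>This inclusion is the one that the order-reversing \<open>QC\<close> turns into
    the inclusion wanted below.\<close>
  have "centr H \<subseteq> conjugate_set n (centr H)"
  proof
    fix x assume x: "x \<in> centr H"
    have "inv n \<in> normalizer G H"
      by (rule subgroup.m_inv_closed[OF normalizer_imp_subgroup[OF H(4)] n])
    then have "conjugate_set (inv n) H = H" using H(4) by (simp add: normalizer_iff)
    then have "inv n \<otimes> x \<otimes> n \<in> centr H"
      using conj_mem_centr[OF x, of "inv n"] nc H(4) by simp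
    then show "x \<in> conjugate_set n (centr H)" using x C nc by (auto simp: conjugate_set_iff)
  qed
  then have "QC (conjugate_set n (centr H)) \<subseteq> QC (centr H)"
    by (intro QC_antimono germ_le_subset)
  then show "n \<otimes> d \<otimes> inv n \<in> QC H \<inter> QC (centr H)"
    using conj_mem_QC[of d H n] conj_mem_QC[of d "centr H" n] d nc H(4) C by auto
qed

lemma centr_subset_QC: "K \<subseteq> carrier G \<Longrightarrow> centr K \<subseteq> QC K"
  by (intro subsetI, rule mem_QC_I[OF _ openin_whole]) (auto simp: centraliser_in_def)

text \<open>A bootstrap in two passes. The first treats only elements of QC(H) that normalise
  \<open>H\<close>; it determines the germ of QC(H) and thereby shows that QC(C(H)) is normal. The
  second uses this normality to treat all elements.\<close>

lemma QC_eq_centr_if_germ_invariant: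
  assumes H: "cln H" "\<And>g. g \<in> carrier G \<Longrightarrow> germ_le (conjugate_set g H) H"
    and D: "QC H \<inter> QC (centr H) = {\<one>}"
  shows "QC H = centr H"
proof
  note H' = clnD[OF H(1)]
  show "centr H \<subseteq> QC H" by (rule centr_subset_QC[OF H'(4)])
  have C: "centr H \<subseteq> carrier G" by (rule subgroup.subset[OF subgroup_centr[OF H'(4)]])
  have H_QC: "H \<subseteq> QC (centr H)"
    using H'(4) centr_subset_QC[OF C] by (auto simp: centraliser_in_def)
  have "germ_le H (conjugate_set g H)" if g: "g \<in> carrier G" for g
    using germ_le_conjugate_set[OF H(2)[of "inv g"] g] g H'(4)
    by (simp add: conjugate_set_cancel conjugate_set_subset)
  then have A: "QC H \<lhd> G" by (rule normal_QC[OF H'(4)])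
  have As: "subgroup (QC H) G" by (rule normal_imp_subgroup[OF A])
  have Ac: "QC H \<subseteq> carrier G" by (rule subgroup.subset[OF As])
  \<comment> \<open>Shared by both passes: normality of QC(H) already puts the commutators in QC(H),
    so membership in QC(C(H)) makes them trivial by \<open>D\<close>.\<close>
  have commute: "x \<in> centr H"
    if x: "x \<in> QC H" and comm: "\<And>h. h \<in> H \<Longrightarrow> x \<otimes> h \<otimes> inv x \<otimes> inv h \<in> QC (centr H)" for x
  proof -
    have xc: "x \<in> carrier G" using x Ac by auto
    have "x \<otimes> h = h \<otimes> x" if h: "h \<in> H" for h
    proof -
      have hc: "h \<in> carrier G" using h H'(4) by auto
      have "x \<otimes> (h \<otimes> inv x \<otimes> inv h) \<in> QC H"
        using subgroup.m_closed[OF As x normal_invE(2)[OF A hc subgroup.m_inv_closed[OF As x]]] .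
      then have "x \<otimes> h \<otimes> inv x \<otimes> inv h \<in> QC H \<inter> QC (centr H)"
        using comm[OF h] xc hc by (simp add: m_assoc)
      then have "x \<otimes> h \<otimes> inv x \<otimes> inv h = \<one>" unfolding D by simp
      then show ?thesis by (rule commute_if_commutator_one[OF xc hc])
    qed
    then show ?thesis using xc by (simp add: centraliser_in_def)
  qed
  \<comment> \<open>First pass: for \<open>y\<close> normalising \<open>H\<close> the commutators
    lie in \<open>H\<close>, which is contained in QC(C(H)).\<close>
  have near: "QC H \<inter> normalizer G H \<subseteq> centr H"
  proof
    fix y assume y: "y \<in> QC H \<inter> normalizer G H"
    show "y \<in> centr H"
    proof (rule commute)
      fix h assume h: "h \<in> H"
      have "y \<otimes> h \<otimes> inv y \<in> H" using y h by (intro normalizer_conj_closed[OF H'(4)]) auto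
      then have "y \<otimes> h \<otimes> inv y \<otimes> inv h \<in> H"
        using h by (simp add: subgroup.m_closed[OF H'(1)] subgroup.m_inv_closed[OF H'(1)])
      then show "y \<otimes> h \<otimes> inv y \<otimes> inv h \<in> QC (centr H)" using H_QC by auto
    qed (use y in simp)
  qed
  have germ: "germ_le (QC H) (centr H)"
    by (rule germ_leI[OF H'(3) one_in_normalizer[OF H'(4)] near])
  \<comment> \<open>QC(H) and C(H) have the same germ, so their quasi-centralisers coincide; that of
    the normal subgroup QC(H) is normal.\<close>
  have QC_C: "QC (centr H) = QC (QC H)"
    using QC_antimono[OF germ] QC_antimono[OF germ_le_subset[OF centr_subset_QC[OF H'(4)]]]
    by (rule equalityI)
  have B: "QC (centr H) \<lhd> G"
    unfolding QC_C by (rule normal_QC[OF Ac]) (simp add: conjugate_set_normal[OF A] germ_le_subset)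
  have Bs: "subgroup (QC (centr H)) G" by (rule normal_imp_subgroup[OF B])
  show "QC H \<subseteq> centr H"
  proof
    fix x assume x: "x \<in> QC H"
    show "x \<in> centr H"
    \<comment> \<open>Second pass: \<open>h\<close> lies in the normal subgroup QC(C(H)), hence so
      do its commutators with any \<open>x\<close>.\<close>
    proof (rule commute[OF x])
      fix h assume h: "h \<in> H"
      then have h': "h \<in> QC (centr H)" using H_QC by auto
      show "x \<otimes> h \<otimes> inv x \<otimes> inv h \<in> QC (centr H)"
        using normal_invE(2)[OF B _ h', of x] x Ac subgroup.m_inv_closed[OF Bs h']
        by (auto intro: subgroup.m_closed[OF Bs])
    qed
  qed
qed

text \<open>Elements near the identity normalise both \<open>H\<close> and \<open>K\<close>, so the
  commutators of \<open>H\<close> with \<open>K\<close> lie in \<open>H \<inter> K\<close>, which is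
  trivial near the identity.\<close>

lemma locally_commute_if_Int_trivial:
  assumes "cln H" "cln K" "germ_le (H \<inter> K) {\<one>}"
  obtains U where "openin T U" "\<one> \<in> U" "\<And>h k. h \<in> H \<inter> U \<Longrightarrow> k \<in> K \<inter> U \<Longrightarrow> k \<otimes> h = h \<otimes> k"
proof -
  note H = clnD[OF assms(1)] and K = clnD[OF assms(2)]
  obtain V where V: "openin T V" "\<one> \<in> V" "H \<inter> K \<inter> V \<subseteq> {\<one>}" using assms(3) by (rule germ_leE)
  have "openin T (V \<inter> (normalizer G H \<inter> normalizer G K))"
    using V(1) H(3) K(3) by (intro openin_Int)
  moreover have "\<one> \<in> V \<inter> (normalizer G H \<inter> normalizer G K)"
    using V(2) one_in_normalizer[OF H(4)] one_in_normalizer[OF K(4)] by simp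
  \<comment> \<open>Taking a subgroup keeps the commutators inside \<open>V\<close>.\<close>
  ultimately obtain U where U: "subgroup U G" "openin T U" "compactin T U"
    "U \<subseteq> V \<inter> (normalizer G H \<inter> normalizer G K)" by (rule van_Dantzig)
  show thesis
  proof (rule that[OF U(2) subgroup.one_closed[OF U(1)]])
    fix h k assume h: "h \<in> H \<inter> U" and k: "k \<in> K \<inter> U"
    have c: "h \<in> carrier G" "k \<in> carrier G" using h k H(4) K(4) by auto
    have "k \<otimes> h \<otimes> inv k \<in> H" using h k U(4) by (intro normalizer_conj_closed[OF H(4)]) auto
    then have "k \<otimes> h \<otimes> inv k \<otimes> inv h \<in> H"
      using h by (simp add: subgroup.m_closed[OF H(1)] subgroup.m_inv_closed[OF H(1)])
    moreover have "h \<otimes> inv k \<otimes> inv h \<in> K"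
      using h k U(4) subgroup.m_inv_closed[OF K(1)] by (intro normalizer_conj_closed[OF K(4)]) auto
    then have "k \<otimes> (h \<otimes> inv k \<otimes> inv h) \<in> K" using k by (simp add: subgroup.m_closed[OF K(1)])
    then have "k \<otimes> h \<otimes> inv k \<otimes> inv h \<in> K" using c by (simp add: m_assoc)
    moreover have "k \<otimes> h \<otimes> inv k \<otimes> inv h \<in> V"
      using h k U(4) subgroup.m_closed[OF U(1)] subgroup.m_inv_closed[OF U(1)] by auto
    ultimately have "k \<otimes> h \<otimes> inv k \<otimes> inv h = \<one>" using V(3) by auto
    then show "k \<otimes> h = h \<otimes> k" by (rule commute_if_commutator_one[OF c(2,1)])
  qed
qed

text \<open>Otherwise C(H) and C(C(H)) would be nontrivial closed normal subgroups with trivial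
  intersection, contradicting the existence of a monolith.\<close>

lemma germ_Int_nontrivial:
  assumes mono: "monolithic G T" and stable: "locally_C_stable G T" and QZ: "quasi_centre G T = {\<one>}"
    and H: "cln H" "\<And>g. g \<in> carrier G \<Longrightarrow> germ_le (conjugate_set g H) H" "\<not> germ_le H {\<one>}"
    and K: "cln K" "\<not> germ_le K {\<one>}"
  shows "\<not> germ_le (H \<inter> K) {\<one>}"
proof
  assume "germ_le (H \<inter> K) {\<one>}"
  then obtain U where U: "openin T U" "\<one> \<in> U"
      "\<And>h k. h \<in> H \<inter> U \<Longrightarrow> k \<in> K \<inter> U \<Longrightarrow> k \<otimes> h = h \<otimes> k"
    using locally_commute_if_Int_trivial[OF H(1) K(1)] by metis
  note H' = clnD[OF H(1)] and K' = clnD[OF K(1)]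
  let ?M = "carrier G \<inter> \<Inter>{N. N \<lhd> G \<and> closedin T N \<and> N \<noteq> {\<one>}}"
  have M: "?M \<subseteq> N" if "N \<lhd> G" "closedin T N" "N \<noteq> {\<one>}" for N using that by auto
  have "C_stable G T H" using stable H(1) by (simp add: locally_C_stable_def)
  then have D: "QC H \<inter> QC (centr H) = {\<one>}" by (rule QC_Int_QC_centr_trivial[OF H(1) _ QZ])
  \<comment> \<open>The equality joins the two properties required for comparison with
    \<open>?M\<close>: the left side is normal and the right side is closed.\<close>
  have eq: "QC H = centr H" by (rule QC_eq_centr_if_germ_invariant[OF H(1,2) D])
  have "germ_le H (conjugate_set g H)" if g: "g \<in> carrier G" for g
    using germ_le_conjugate_set[OF H(2)[of "inv g"] g] g H'(4)
    by (simp add: conjugate_set_cancel conjugate_set_subset)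
  then have A: "centr H \<lhd> G" using normal_QC[OF H'(4)] eq by simp
  have Ac: "centr H \<subseteq> carrier G" by (rule subgroup.subset[OF normal_imp_subgroup[OF A]])
  \<comment> \<open>Elements of \<open>K\<close> near the identity witness that C(H) is
    nontrivial.\<close>
  have "K \<inter> U \<subseteq> QC H"
    using K'(4) by (auto intro!: mem_QC_I[OF _ U(1,2)] U(3))
  moreover have "\<not> K \<inter> U \<subseteq> {\<one>}" using K(2) germ_leI[OF U(1,2)] by auto
  ultimately have "centr H \<noteq> {\<one>}" using eq by auto
  then have M1: "?M \<subseteq> centr H" by (intro M A closedin_centr[OF H'(4)])
  have "H \<subseteq> centr (centr H)" using H'(4) by (auto simp: centraliser_in_def)
  then have "centr (centr H) \<noteq> {\<one>}" using H(3) germ_le_subset[of H "{\<one>}"] by auto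
  then have M2: "?M \<subseteq> centr (centr H)" by (intro M normal_centr[OF A] closedin_centr[OF Ac])
  \<comment> \<open>C(H) is QC(H), and C(C(H)) is contained in QC(C(H)), so \<open>D\<close>
    applies.\<close>
  have "?M \<subseteq> {\<one>}"
    using M1 M2 centr_subset_QC[OF Ac] eq unfolding D[symmetric] by auto
  moreover have "\<one> \<in> ?M" by (auto simp: normal_imp_subgroup subgroup.one_closed)
  ultimately have "?M = {\<one>}" by auto
  then show False using mono by (simp add: monolithic_def)
qed

lemma meet_closed_LN_fixed:
  assumes mono: "monolithic G T" and stable: "locally_C_stable G T" and QZ: "quasi_centre G T = {\<one>}"
  shows "meet_closed (structure_lattice G T) (LN_fixed G T - {LN_zero G T})"
  unfolding meet_closed_def
proof (intro ballI)
  fix \<alpha> \<beta> assume "\<alpha> \<in> LN_fixed G T - {LN_zero G T}" "\<beta> \<in> LN_fixed G T - {LN_zero G T}"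
  then obtain H K where H: "\<alpha> = germ_class H" "cln H"
      "\<forall>g \<in> carrier G. germ_le (conjugate_set g H) H" "\<not> germ_le H {\<one>}"
      and K: "\<beta> = germ_class K" "cln K"
      "\<forall>g \<in> carrier G. germ_le (conjugate_set g K) K" "\<not> germ_le K {\<one>}"
    unfolding LN_fixed_nonzero_iff by (elim exE conjE)
  note Hc = clnD(4)[OF H(2)] and Kc = clnD(4)[OF K(2)]
  have "germ_le (conjugate_set g (H \<inter> K)) (H \<inter> K)" if g: "g \<in> carrier G" for g
  proof -
    have "conjugate_set g (H \<inter> K) \<subseteq> conjugate_set g H" "conjugate_set g (H \<inter> K) \<subseteq> conjugate_set g K"
      by (auto simp: conjugate_set_def l_coset_def r_coset_def)
    then show ?thesis
      using H(3) K(3) g by (metis germ_le_Int germ_le_subset germ_le_trans)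
  qed
  moreover have "\<not> germ_le (H \<inter> K) {\<one>}"
    using germ_Int_nontrivial[OF mono stable QZ H(2) _ H(4) K(2,4)] H(3) by simp
  ultimately show "\<alpha> \<sqinter>\<^bsub>structure_lattice G T\<^esub> \<beta> \<in> LN_fixed G T - {LN_zero G T}"
    unfolding LN_fixed_nonzero_iff H(1) K(1)
    by (intro exI[of _ "H \<inter> K"]) (simp add: structure_lattice_meet[OF H(2) K(2)] cln_Int[OF H(2) K(2)])
qed

section \<open>Topologically simple groups\<close>

lemma monolithic_if_simple:
  assumes "topologically_simple G T" shows "monolithic G T"
proof -
  have "carrier G \<subseteq> \<Inter>{N. N \<lhd> G \<and> closedin T N \<and> N \<noteq> {\<one>}}"
    using assms unfolding topologically_simple_def by auto
  then have "carrier G \<inter> \<Inter>{N. N \<lhd> G \<and> closedin T N \<and> N \<noteq> {\<one>}} = carrier G"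
    by (rule Int_absorb2)
  then show ?thesis using assms by (simp add: monolithic_def topologically_simple_def)
qed

text \<open>The C-stability of the trivial subgroup says that the quasi-centre is discrete.\<close>

lemma quasi_centre_trivial_if_simple:
  assumes simple: "topologically_simple G T" and "locally_C_stable G T"
    and nondiscrete: "T \<noteq> discrete_topology (carrier G)"
  shows "quasi_centre G T = {\<one>}"
proof -
  let ?Z = "QC (carrier G)"
  \<comment> \<open>For the trivial subgroup both the centraliser and the quasi-centraliser are the
    whole group, so the intersection in \<open>C_stable\<close> is the quasi-centre.\<close>
  have centr_one: "centr {\<one>} = carrier G" by (auto simp: centraliser_in_def)
  then have "QC {\<one>} = carrier G"
    using centr_subset_QC[of "{\<one>}"] by (auto simp: mem_QC_iff)
  moreover have "C_stable G T {\<one>}" using assms(2) cln_one by (simp add: locally_C_stable_def)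
  moreover have "?Z \<subseteq> carrier G" by (auto simp: mem_QC_iff)
  ultimately have discrete: "discrete_in T ?Z"
    by (simp add: C_stable_def centr_one Int_absorb1)
  have "conjugate_set g (carrier G) = carrier G" if "g \<in> carrier G" for g
    using that by (auto simp: conjugate_set_iff)
  then have normal: "?Z \<lhd> G" by (intro normal_QC) (simp_all add: germ_le_subset)
  \<comment> \<open>A discrete subgroup is closed, so simplicity leaves only two possibilities for
    the quasi-centre.\<close>
  then have "closedin T ?Z"
    using discrete by (intro discrete_subgroup_closedin normal_imp_subgroup)
  then have "?Z = {\<one>} \<or> ?Z = carrier G"
    using simple normal unfolding topologically_simple_def by simp
  moreover have "?Z \<noteq> carrier G"
  proof
    assume "?Z = carrier G"
    then have "subtopology T (topspace T) = discrete_topology (carrier G)"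
      using discrete by (simp add: discrete_in_def topspace_eq)
    then show False using nondiscrete by simp
  qed
  ultimately show ?thesis by (simp add: QC_carrier_eq)
qed

end

theorem lemma5p12:
  fixes G :: "('a, 'b) monoid_scheme" and T :: "'a topology"
  assumes "tdlc_group G T"
    and "second_countable_space T"
    and "T \<noteq> discrete_topology (carrier G)"
  shows "(topologically_simple G T \<longrightarrow>
            upper_subset (structure_lattice G T) (LN_fixed G T - {LN_zero G T})) \<and>
         (monolithic G T \<and> locally_C_stable G T \<and> quasi_centre G T = {\<one>\<^bsub>G\<^esub>} \<longrightarrow>
            meet_closed (structure_lattice G T) (LN_fixed G T - {LN_zero G T})) \<and>
         (topologically_simple G T \<and> locally_C_stable G T \<longrightarrow>
            lattice_filter (structure_lattice G T) (LN_fixed G T - {LN_zero G T}))"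
proof -
  interpret tdlc_group G T by (rule assms(1))
  \<comment> \<open>A non-discrete simple group that is locally C-stable satisfies the hypotheses of
    the statement on meets, so the filter property combines the first two statements.\<close>
  show ?thesis
    unfolding lattice_filter_def
    using upper_subset_LN_fixed meet_closed_LN_fixed monolithic_if_simple
      quasi_centre_trivial_if_simple[OF _ _ assms(3)] by simp
qed

end
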